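(* The category $\mathbf{Cal^0_{Sym}}$, equipped with the tensor bifunctor $\circledast$, unit object the two-element lattice $2$, internal hom $\mathcal{L}_1\multimap\mathcal{L}_2:=(\mathcal{L}_1\circledast\mathcal{L}_2^{\mathrm{op}})^{\mathrm{op}}$, and dualizing object $2$, is a $\ast$-autonomous category (i.e. symmetric monoidal closed with $2$ as dualizing object, so that $\mathcal{L}\multimap 2\cong\mathcal{L}^{\mathrm{op}}$ and the canonical arrow $\mathcal{L}\to(\mathcal{L}\multimap2)\multimap2$ is an isomorphism for every $\mathcal{L}$).
   Context: Lattice notation: $\Sigma_i,\Sigma_i'$ atoms and coatoms; $\Sigma[a]$, $\Sigma'[a]$ atoms below / coatoms above $a$; $\mathsf{Cl}(\omega)=\{\Sigma[a];a\in\omega\}$; $\mathcal{L}^{\mathrm{op}}$ dual lattice; $f^\circ(b):=\bigvee\{a;f(a)\le b\}$. $\mathbf{Cal^0_{Sym}}$: objects are complete atomistic coatomistic lattices with $\Sigma[x]\cup\Sigma[y]\ne\Sigma$ for all coatoms $x,y$ and $\Sigma'[p]\cup\Sigma'[q]\ne\Sigma'$ for all atoms $p,q$; arrows are maps preserving arbitrary joins, sending atoms to atoms or $0$, with $f^\circ$ sending coatoms to coatoms or $1$. $\Sigma'_\circledast$ is the set of $R\subsetneqq\Sigma_1\times\Sigma_2$ such that for every $(p_1,p_2)\in\Sigma_1\times\Sigma_2$, $\{q_1;(q_1,p_2)\in R\}\in\mathsf{Cl}(\Sigma_1'\cup\{1\})$ and $\{q_2;(p_1,q_2)\in R\}\in\mathsf{Cl}(\Sigma_2'\cup\{1\})$;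 $\mathcal{L}_1\circledast\mathcal{L}_2:=\{\bigcap\omega;\omega\subseteq\Sigma'_\circledast\cup\{\Sigma_1\times\Sigma_2\}\}$ ordered by inclusion; on arrows $f_1\circledast f_2$ is the join-preserving map sending the atom $\{(p_1,p_2)\}$ to $\{(f_1(p_1),f_2(p_2))\}$ if both are nonzero and to $0$ otherwise. *)

theory Defs
  imports Main "HOL-Library.FuncSet"
begin

record 'a lat =
  lcarrier :: "'a set"
  lle :: "'a \<Rightarrow> 'a \<Rightarrow> bool"

definition is_lub :: "'a lat \<Rightarrow> 'a set \<Rightarrow> 'a \<Rightarrow> bool" where
  "is_lub L A x \<longleftrightarrow> x \<in> lcarrier L \<and> (\<forall>a\<in>A. lle L a x)
     \<and> (\<forall>y\<in>lcarrier L. (\<forall>a\<in>A. lle L a y) \<longrightarrow> lle L x y)"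

definition Join :: "'a lat \<Rightarrow> 'a set \<Rightarrow> 'a" where
  "Join L A = (THE x. is_lub L A x)"

definition dual_lat :: "'a lat \<Rightarrow> 'a lat" where
  "dual_lat L = \<lparr>lcarrier = lcarrier L, lle = (\<lambda>x y. lle L y x)\<rparr>"

definition Meet :: "'a lat \<Rightarrow> 'a set \<Rightarrow> 'a" where
  "Meet L A = Join (dual_lat L) A"

definition lbot :: "'a lat \<Rightarrow> 'a" where "lbot L = Join L {}"
definition ltop :: "'a lat \<Rightarrow> 'a" where "ltop L = Meet L {}"

definition complete_lat :: "'a lat \<Rightarrow> bool" where
  "complete_lat L \<longleftrightarrow>
     (\<forall>x\<in>lcarrier L. lle L x x) \<and>
     (\<forall>x\<in>lcarrier L. \<forall>y\<in>lcarrier L. lle L x y \<and> lle L y x \<longrightarrow> x = y) \<and>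
     (\<forall>x\<in>lcarrier L. \<forall>y\<in>lcarrier L. \<forall>z\<in>lcarrier L. lle L x y \<and> lle L y z \<longrightarrow> lle L x z) \<and>
     (\<forall>A. A \<subseteq> lcarrier L \<longrightarrow> (\<exists>x. is_lub L A x))"

definition atoms :: "'a lat \<Rightarrow> 'a set" where
  "atoms L = {p \<in> lcarrier L. p \<noteq> lbot L \<and> (\<forall>x\<in>lcarrier L. lle L x p \<longrightarrow> x = lbot L \<or> x = p)}"

definition coatoms :: "'a lat \<Rightarrow> 'a set" where
  "coatoms L = atoms (dual_lat L)"

definition atoms_below :: "'a lat \<Rightarrow> 'a \<Rightarrow> 'a set" where
  "atoms_below L a = {p \<in> atoms L. lle L p a}"

definition coatoms_above :: "'a lat \<Rightarrow> 'a \<Rightarrow> 'a set" where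
  "coatoms_above L a = {c \<in> coatoms L. lle L a c}"

definition atomistic :: "'a lat \<Rightarrow> bool" where
  "atomistic L \<longleftrightarrow> (\<forall>a\<in>lcarrier L. a = Join L (atoms_below L a))"

definition coatomistic :: "'a lat \<Rightarrow> bool" where
  "coatomistic L \<longleftrightarrow> (\<forall>a\<in>lcarrier L. a = Meet L (coatoms_above L a))"

definition cal0sym_obj :: "'a lat \<Rightarrow> bool" where
  "cal0sym_obj L \<longleftrightarrow> complete_lat L \<and> atomistic L \<and> coatomistic L \<and>
     (\<forall>x\<in>coatoms L. \<forall>y\<in>coatoms L. atoms_below L x \<union> atoms_below L y \<noteq> atoms L) \<and>
     (\<forall>p\<in>atoms L. \<forall>q\<in>atoms L. coatoms_above L p \<union> coatoms_above L q \<noteq> coatoms L)"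

definition adj :: "'a lat \<Rightarrow> 'b lat \<Rightarrow> ('a \<Rightarrow> 'b) \<Rightarrow> 'b \<Rightarrow> 'a" where
  "adj L1 L2 f b = Join L1 {a \<in> lcarrier L1. lle L2 (f a) b}"

definition Hom :: "'a lat \<Rightarrow> 'b lat \<Rightarrow> ('a \<Rightarrow> 'b) set" where
  "Hom L1 L2 = {f. f \<in> extensional (lcarrier L1) \<and> f \<in> lcarrier L1 \<rightarrow> lcarrier L2 \<and>
     (\<forall>A. A \<subseteq> lcarrier L1 \<longrightarrow> f (Join L1 A) = Join L2 (f ` A)) \<and>
     (\<forall>p\<in>atoms L1. f p \<in> atoms L2 \<union> {lbot L2}) \<and>
     (\<forall>c\<in>coatoms L2. adj L1 L2 f c \<in> coatoms L1 \<union> {ltop L1})}"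

definition idA :: "'a lat \<Rightarrow> 'a \<Rightarrow> 'a" where
  "idA L = restrict (\<lambda>x. x) (lcarrier L)"

definition iso :: "'a lat \<Rightarrow> 'b lat \<Rightarrow> ('a \<Rightarrow> 'b) \<Rightarrow> bool" where
  "iso L1 L2 f \<longleftrightarrow> f \<in> Hom L1 L2 \<and>
     (\<exists>g\<in>Hom L2 L1. compose (lcarrier L1) g f = idA L1 \<and> compose (lcarrier L2) f g = idA L2)"

definition Cl :: "'a lat \<Rightarrow> 'a set \<Rightarrow> 'a set set" where
  "Cl L \<omega> = atoms_below L ` \<omega>"

definition tsr_gen :: "'a lat \<Rightarrow> 'b lat \<Rightarrow> ('a \<times> 'b) set set" where
  "tsr_gen L1 L2 = {R. R \<subset> atoms L1 \<times> atoms L2 \<and>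
     (\<forall>p1\<in>atoms L1. \<forall>p2\<in>atoms L2.
        {q1. (q1, p2) \<in> R} \<in> Cl L1 (coatoms L1 \<union> {ltop L1}) \<and>
        {q2. (p1, q2) \<in> R} \<in> Cl L2 (coatoms L2 \<union> {ltop L2}))}"

text \<open>Intersections are taken inside \<Sigma>1 \<times> \<Sigma>2 (empty intersection = \<Sigma>1 \<times> \<Sigma>2).\<close>
definition tensor :: "'a lat \<Rightarrow> 'b lat \<Rightarrow> ('a \<times> 'b) set lat" where
  "tensor L1 L2 = \<lparr>lcarrier = {(atoms L1 \<times> atoms L2) \<inter> \<Inter>\<omega> | \<omega>.
        \<omega> \<subseteq> tsr_gen L1 L2 \<union> {atoms L1 \<times> atoms L2}},
     lle = (\<subseteq>)\<rparr>"

text \<open>f1 \<circledast> f2: join-preserving extension of {(p1,p2)} \<mapsto> {(f1 p1, f2 p2)} (or 0).\<close>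
definition tensor_arr :: "'a lat \<Rightarrow> 'b lat \<Rightarrow> 'c lat \<Rightarrow> 'd lat \<Rightarrow> ('a \<Rightarrow> 'c) \<Rightarrow> ('b \<Rightarrow> 'd)
     \<Rightarrow> ('a \<times> 'b) set \<Rightarrow> ('c \<times> 'd) set" where
  "tensor_arr L1 L2 M1 M2 f1 f2 = restrict
     (\<lambda>R. Join (tensor M1 M2) {{(f1 p1, f2 p2)} | p1 p2.
        (p1, p2) \<in> R \<and> f1 p1 \<noteq> lbot M1 \<and> f2 p2 \<noteq> lbot M2})
     (lcarrier (tensor L1 L2))"

definition two :: "bool lat" where
  "two = \<lparr>lcarrier = UNIV, lle = (\<le>)\<rparr>"

definition ihom :: "'a lat \<Rightarrow> 'b lat \<Rightarrow> ('a \<times> 'b) set lat" where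
  "ihom L1 L2 = dual_lat (tensor L1 (dual_lat L2))"

section \<open>Canonical structure maps (join-preserving extensions of maps on atoms)\<close>

definition assoc :: "'a lat \<Rightarrow> 'b lat \<Rightarrow> 'c lat \<Rightarrow> (('a \<times> 'b) set \<times> 'c) set \<Rightarrow> ('a \<times> ('b \<times> 'c) set) set" where
  "assoc L1 L2 L3 = restrict
     (\<lambda>X. Join (tensor L1 (tensor L2 L3)) {{(p1, {(p2, p3)})} | p1 p2 p3. ({(p1, p2)}, p3) \<in> X})
     (lcarrier (tensor (tensor L1 L2) L3))"

definition lunit :: "'a lat \<Rightarrow> (bool \<times> 'a) set \<Rightarrow> 'a" where
  "lunit L = restrict (\<lambda>X. Join L {p. (True, p) \<in> X}) (lcarrier (tensor two L))"

definition runit :: "'a lat \<Rightarrow> ('a \<times> bool) set \<Rightarrow> 'a" where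
  "runit L = restrict (\<lambda>X. Join L {p. (p, True) \<in> X}) (lcarrier (tensor L two))"

definition symm :: "'a lat \<Rightarrow> 'b lat \<Rightarrow> ('a \<times> 'b) set \<Rightarrow> ('b \<times> 'a) set" where
  "symm L1 L2 = restrict (\<lambda>X. (\<lambda>(p, q). (q, p)) ` X) (lcarrier (tensor L1 L2))"

text \<open>Evaluation (L2 \<multimap> L3) \<circledast> L2 \<rightarrow> L3: an atom R of L2 \<multimap> L3 is a relation
  R \<subseteq> \<Sigma>2 \<times> \<Sigma>'3; the atom {(R,p2)} is sent to the meet of the coatoms q with (p2,q) \<in> R.\<close>
definition ev :: "'b lat \<Rightarrow> 'c lat \<Rightarrow> (('b \<times> 'c) set \<times> 'b) set \<Rightarrow> 'c" where
  "ev L2 L3 = restrict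
     (\<lambda>X. Join L3 {Meet L3 {q. (p2, q) \<in> R} | R p2. (R, p2) \<in> X})
     (lcarrier (tensor (ihom L2 L3) L2))"

definition category_laws :: "'a lat \<Rightarrow> 'b lat \<Rightarrow> 'c lat \<Rightarrow> ('a \<Rightarrow> 'b) \<Rightarrow> ('b \<Rightarrow> 'c) \<Rightarrow> bool" where
  "category_laws L M N f g \<longleftrightarrow>
     (cal0sym_obj L \<and> cal0sym_obj M \<and> cal0sym_obj N \<and> f \<in> Hom L M \<and> g \<in> Hom M N \<longrightarrow>
        idA L \<in> Hom L L \<and> compose (lcarrier L) g f \<in> Hom L N)"

definition tensor_bifunctor_laws ::
  "'a lat \<Rightarrow> 'b lat \<Rightarrow> 'c lat \<Rightarrow> 'd lat \<Rightarrow> 'e lat \<Rightarrow> 'f lat \<Rightarrow>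
   ('a \<Rightarrow> 'c) \<Rightarrow> ('b \<Rightarrow> 'd) \<Rightarrow> ('c \<Rightarrow> 'e) \<Rightarrow> ('d \<Rightarrow> 'f) \<Rightarrow> bool" where
  "tensor_bifunctor_laws L1 L2 M1 M2 N1 N2 f1 f2 g1 g2 \<longleftrightarrow>
     (cal0sym_obj L1 \<and> cal0sym_obj L2 \<and> cal0sym_obj M1 \<and> cal0sym_obj M2 \<and>
      cal0sym_obj N1 \<and> cal0sym_obj N2 \<and>
      f1 \<in> Hom L1 M1 \<and> f2 \<in> Hom L2 M2 \<and> g1 \<in> Hom M1 N1 \<and> g2 \<in> Hom M2 N2 \<longrightarrow>
        cal0sym_obj (tensor L1 L2) \<and>
        tensor_arr L1 L2 M1 M2 f1 f2 \<in> Hom (tensor L1 L2) (tensor M1 M2) \<and>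
        tensor_arr L1 L2 L1 L2 (idA L1) (idA L2) = idA (tensor L1 L2) \<and>
        tensor_arr L1 L2 N1 N2 (compose (lcarrier L1) g1 f1) (compose (lcarrier L2) g2 f2)
          = compose (lcarrier (tensor L1 L2)) (tensor_arr M1 M2 N1 N2 g1 g2)
              (tensor_arr L1 L2 M1 M2 f1 f2))"

definition assoc_laws ::
  "'a lat \<Rightarrow> 'b lat \<Rightarrow> 'c lat \<Rightarrow> 'd lat \<Rightarrow> 'e lat \<Rightarrow> 'f lat \<Rightarrow>
   ('a \<Rightarrow> 'd) \<Rightarrow> ('b \<Rightarrow> 'e) \<Rightarrow> ('c \<Rightarrow> 'f) \<Rightarrow> bool" where
  "assoc_laws L1 L2 L3 M1 M2 M3 f1 f2 f3 \<longleftrightarrow>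
     (cal0sym_obj L1 \<and> cal0sym_obj L2 \<and> cal0sym_obj L3 \<and>
      cal0sym_obj M1 \<and> cal0sym_obj M2 \<and> cal0sym_obj M3 \<and>
      f1 \<in> Hom L1 M1 \<and> f2 \<in> Hom L2 M2 \<and> f3 \<in> Hom L3 M3 \<longrightarrow>
        iso (tensor (tensor L1 L2) L3) (tensor L1 (tensor L2 L3)) (assoc L1 L2 L3) \<and>
        compose (lcarrier (tensor (tensor L1 L2) L3))
          (tensor_arr L1 (tensor L2 L3) M1 (tensor M2 M3) f1 (tensor_arr L2 L3 M2 M3 f2 f3))
          (assoc L1 L2 L3)
        = compose (lcarrier (tensor (tensor L1 L2) L3))
          (assoc M1 M2 M3)
          (tensor_arr (tensor L1 L2) L3 (tensor M1 M2) M3 (tensor_arr L1 L2 M1 M2 f1 f2) f3))"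

definition unit_laws :: "'a lat \<Rightarrow> 'b lat \<Rightarrow> ('a \<Rightarrow> 'b) \<Rightarrow> bool" where
  "unit_laws L M f \<longleftrightarrow>
     (cal0sym_obj L \<and> cal0sym_obj M \<and> f \<in> Hom L M \<longrightarrow>
        iso (tensor two L) L (lunit L) \<and> iso (tensor L two) L (runit L) \<and>
        compose (lcarrier (tensor two L)) f (lunit L)
          = compose (lcarrier (tensor two L)) (lunit M) (tensor_arr two L two M (idA two) f) \<and>
        compose (lcarrier (tensor L two)) f (runit L)
          = compose (lcarrier (tensor L two)) (runit M) (tensor_arr L two M two f (idA two)))"

definition symmetry_laws ::
  "'a lat \<Rightarrow> 'b lat \<Rightarrow> 'c lat \<Rightarrow> 'd lat \<Rightarrow> ('a \<Rightarrow> 'c) \<Rightarrow> ('b \<Rightarrow> 'd) \<Rightarrow> bool" where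
  "symmetry_laws L1 L2 M1 M2 f1 f2 \<longleftrightarrow>
     (cal0sym_obj L1 \<and> cal0sym_obj L2 \<and> cal0sym_obj M1 \<and> cal0sym_obj M2 \<and>
      f1 \<in> Hom L1 M1 \<and> f2 \<in> Hom L2 M2 \<longrightarrow>
        iso (tensor L1 L2) (tensor L2 L1) (symm L1 L2) \<and>
        compose (lcarrier (tensor L1 L2)) (symm L2 L1) (symm L1 L2) = idA (tensor L1 L2) \<and>
        compose (lcarrier (tensor L1 L2)) (symm M1 M2) (tensor_arr L1 L2 M1 M2 f1 f2)
          = compose (lcarrier (tensor L1 L2)) (tensor_arr L2 L1 M2 M1 f2 f1) (symm L1 L2))"

definition pentagon_law :: "'a lat \<Rightarrow> 'b lat \<Rightarrow> 'c lat \<Rightarrow> 'd lat \<Rightarrow> bool" where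
  "pentagon_law L1 L2 L3 L4 \<longleftrightarrow>
     (cal0sym_obj L1 \<and> cal0sym_obj L2 \<and> cal0sym_obj L3 \<and> cal0sym_obj L4 \<longrightarrow>
       compose (lcarrier (tensor (tensor (tensor L1 L2) L3) L4))
         (assoc L1 L2 (tensor L3 L4)) (assoc (tensor L1 L2) L3 L4)
       = compose (lcarrier (tensor (tensor (tensor L1 L2) L3) L4))
           (tensor_arr L1 (tensor (tensor L2 L3) L4) L1 (tensor L2 (tensor L3 L4))
              (idA L1) (assoc L2 L3 L4))
           (compose (lcarrier (tensor (tensor (tensor L1 L2) L3) L4))
              (assoc L1 (tensor L2 L3) L4)
              (tensor_arr (tensor (tensor L1 L2) L3) L4 (tensor L1 (tensor L2 L3)) L4
                 (assoc L1 L2 L3) (idA L4))))"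

definition triangle_law :: "'a lat \<Rightarrow> 'b lat \<Rightarrow> bool" where
  "triangle_law L1 L2 \<longleftrightarrow>
     (cal0sym_obj L1 \<and> cal0sym_obj L2 \<longrightarrow>
       compose (lcarrier (tensor (tensor L1 two) L2))
         (tensor_arr L1 (tensor two L2) L1 L2 (idA L1) (lunit L2)) (assoc L1 two L2)
       = tensor_arr (tensor L1 two) L2 L1 L2 (runit L1) (idA L2))"

definition hexagon_law :: "'a lat \<Rightarrow> 'b lat \<Rightarrow> 'c lat \<Rightarrow> bool" where
  "hexagon_law A B C \<longleftrightarrow>
     (cal0sym_obj A \<and> cal0sym_obj B \<and> cal0sym_obj C \<longrightarrow>
       compose (lcarrier (tensor (tensor A B) C))
         (assoc B C A)
         (compose (lcarrier (tensor (tensor A B) C)) (symm A (tensor B C)) (assoc A B C))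
       = compose (lcarrier (tensor (tensor A B) C))
         (tensor_arr B (tensor A C) B (tensor C A) (idA B) (symm A C))
         (compose (lcarrier (tensor (tensor A B) C))
            (assoc B A C)
            (tensor_arr (tensor A B) C (tensor B A) C (symm A B) (idA C))))"

definition closed_law :: "'a lat \<Rightarrow> 'b lat \<Rightarrow> 'c lat \<Rightarrow> bool" where
  "closed_law L1 L2 L3 \<longleftrightarrow>
     (cal0sym_obj L1 \<and> cal0sym_obj L2 \<and> cal0sym_obj L3 \<longrightarrow>
       cal0sym_obj (ihom L2 L3) \<and> ev L2 L3 \<in> Hom (tensor (ihom L2 L3) L2) L3 \<and>
       (\<forall>f\<in>Hom (tensor L1 L2) L3. \<exists>!g. g \<in> Hom L1 (ihom L2 L3) \<and>
          compose (lcarrier (tensor L1 L2)) (ev L2 L3)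
            (tensor_arr L1 L2 (ihom L2 L3) L2 g (idA L2)) = f))"

text \<open>Dualizing object 2: L \<multimap> 2 \<cong> L^op, and the canonical arrow
  L \<rightarrow> (L \<multimap> 2) \<multimap> 2 (the transpose of ev \<circ> symmetry) is an isomorphism.\<close>
definition dualizing_law :: "'a lat \<Rightarrow> bool" where
  "dualizing_law L \<longleftrightarrow>
     (cal0sym_obj L \<longrightarrow>
       (\<exists>h. iso (ihom L two) (dual_lat L) h) \<and>
       (\<exists>g. g \<in> Hom L (ihom (ihom L two) two) \<and>
          compose (lcarrier (tensor L (ihom L two))) (ev (ihom L two) two)
            (tensor_arr L (ihom L two) (ihom (ihom L two) two) (ihom L two) g (idA (ihom L two)))
          = compose (lcarrier (tensor L (ihom L two))) (ev L two) (symm L (ihom L two)) \<and>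
          iso L (ihom (ihom L two) two) g))"

end

theory Submission
  imports Defs
begin

text \<open>
  An object is determined by its atoms together with the family of coatomic sets, i.e. the sets of
  atoms below a coatom or below \<open>1\<close>, and an arrow by its values on atoms: a map from atoms to atoms or
  \<open>0\<close> extends to an arrow iff preimages of coatomic sets are coatomic. In these terms the coatomic sets
  of \<open>L1 \<circledast> L2\<close> are exactly the relations all of whose one-variable fibres are coatomic; that these
  relations are pairwise incomparable (hence coatoms) uses that two coatoms never cover all atoms.
  The fibre condition is symmetric and associative, and every coherence diagram can be checked on
  atoms. An atom of \<open>L2 \<multimap> L3\<close> is a relation between atoms of \<open>L2\<close> and coatoms of \<open>L3\<close>, so that an arrow
  \<open>f\<close> on \<open>L1 \<circledast> L2\<close> and its transpose carry the same information, namely the ternary relation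
  \<open>f (p, q) \<le> c\<close>.
\<close>

section \<open>Complete lattices\<close>

text \<open>Joins in a tensor product are closures under intersection and have no convenient
  formula. Identities are therefore tested on atoms of the source and against coatoms of the target,
  where the order is membership of a pair in a relation. Join preservation of a map \<open>F\<close>
  likewise comes from finding, for each coatom \<open>c\<close> of the target, an element
  \<open>d\<close> with \<open>F x\<close> below \<open>c\<close> iff \<open>x\<close> is below
  \<open>d\<close>; this \<open>d\<close> is then the value of the adjoint. Two degenerate cases
  shape the details. Atoms may be sent to 0, which lies below every coatom but belongs to no set of
  atoms, so conditions on images carry a guard or a case split. And the one-element lattice is an
  object: it has no atoms, so a condition quantified over the atoms of both factors says nothing
  when one factor is trivial. The axioms of an object are self-dual, so many facts about coatoms are
  read off from the dual lattice.\<close>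

lemma lat_carrier_dual [simp]: "lcarrier (dual_lat L) = lcarrier L"
  and lle_dual [simp]: "lle (dual_lat L) x y = lle L y x"
  by (simp_all add: dual_lat_def)

lemma dual_dual [simp]: "dual_lat (dual_lat L) = L"
  by (simp add: dual_lat_def)

lemma Join_dual: "Join (dual_lat L) = Meet L"
  by (simp add: Meet_def fun_eq_iff)

lemma Meet_dual: "Meet (dual_lat L) = Join L"
  by (simp add: Meet_def fun_eq_iff)

lemma lbot_dual [simp]: "lbot (dual_lat L) = ltop L"
  and ltop_dual [simp]: "ltop (dual_lat L) = lbot L"
  by (simp_all add: lbot_def ltop_def Join_dual Meet_dual)

lemma atoms_dual [simp]: "atoms (dual_lat L) = coatoms L"
  and coatoms_dual [simp]: "coatoms (dual_lat L) = atoms L"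
  by (simp_all add: coatoms_def)

lemma atoms_below_dual [simp]: "atoms_below (dual_lat L) = coatoms_above L"
  and coatoms_above_dual [simp]: "coatoms_above (dual_lat L) = atoms_below L"
  by (simp_all add: fun_eq_iff atoms_below_def coatoms_above_def)

context
  fixes L :: "'a lat"
  assumes L: "complete_lat L"
begin

lemma lle_refl: "x \<in> lcarrier L \<Longrightarrow> lle L x x"
  using L by (simp add: complete_lat_def)

lemma lle_antisym: "lle L x y \<Longrightarrow> lle L y x \<Longrightarrow> x \<in> lcarrier L \<Longrightarrow> y \<in> lcarrier L \<Longrightarrow> x = y"
  using L unfolding complete_lat_def by blast

lemma lle_trans:
  "lle L x y \<Longrightarrow> lle L y z \<Longrightarrow> x \<in> lcarrier L \<Longrightarrow> y \<in> lcarrier L \<Longrightarrow> z \<in> lcarrier L \<Longrightarrow> lle L x z"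
  using L unfolding complete_lat_def by blast

lemma is_lub_Join:
  assumes "A \<subseteq> lcarrier L" shows "is_lub L A (Join L A)"
proof -
  obtain x where x: "is_lub L A x"
    using L assms unfolding complete_lat_def by blast
  then have "y = x" if "is_lub L A y" for y
    using that lle_antisym unfolding is_lub_def by blast
  then show ?thesis
    unfolding Join_def using x by (metis theI)
qed

lemma Join_carrier: "A \<subseteq> lcarrier L \<Longrightarrow> Join L A \<in> lcarrier L"
  using is_lub_Join unfolding is_lub_def by blast

lemma Join_upper: "A \<subseteq> lcarrier L \<Longrightarrow> a \<in> A \<Longrightarrow> lle L a (Join L A)"
  using is_lub_Join unfolding is_lub_def by blast

lemma Join_le_iff:
  assumes "A \<subseteq> lcarrier L" "y \<in> lcarrier L"
  shows "lle L (Join L A) y \<longleftrightarrow> (\<forall>a\<in>A. lle L a y)"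
  using is_lub_Join[OF assms(1)] assms lle_trans unfolding is_lub_def by blast

lemma Join_eqI: "A \<subseteq> lcarrier L \<Longrightarrow> is_lub L A x \<Longrightarrow> Join L A = x"
  using is_lub_Join lle_antisym unfolding is_lub_def by blast

lemma lbot_carrier: "lbot L \<in> lcarrier L"
  by (simp add: lbot_def Join_carrier)

lemma lbot_least: "x \<in> lcarrier L \<Longrightarrow> lle L (lbot L) x"
  by (simp add: lbot_def Join_le_iff)

text \<open>The bottom adds nothing to a join. This reconciles two descriptions of an extension: a
  join over all atoms below \<open>x\<close>, some of them mapped to 0, and the defining set of
  \<open>tensor_arr\<close>, which leaves such atoms out.\<close>

lemma Join_diff_lbot_cong:
  assumes "A \<subseteq> lcarrier L" "B \<subseteq> lcarrier L" "A - {lbot L} = B - {lbot L}"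
  shows "Join L A = Join L B"
proof (rule Join_eqI[OF assms(1)])
  have "(\<forall>a\<in>A. lle L a y) \<longleftrightarrow> (\<forall>a\<in>B. lle L a y)" if "y \<in> lcarrier L" for y
    using assms(3) lbot_least[OF that] by blast
  then show "is_lub L A (Join L B)"
    using is_lub_Join[OF assms(2)] unfolding is_lub_def by blast
qed

lemma complete_lat_dual: "complete_lat (dual_lat L)"
proof -
  have "\<exists>x. is_lub (dual_lat L) A x" if "A \<subseteq> lcarrier L" for A
  proof
    have "{x \<in> lcarrier L. \<forall>a\<in>A. lle L x a} \<subseteq> lcarrier L"
      by blast
    then show "is_lub (dual_lat L) A (Join L {x \<in> lcarrier L. \<forall>a\<in>A. lle L x a})"
      using that by (auto simp: is_lub_def Join_carrier Join_le_iff Join_upper subset_iff)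
  qed
  then show ?thesis
    unfolding complete_lat_def using lle_refl lle_antisym lle_trans by simp blast
qed

lemma atoms_carrier: "p \<in> atoms L \<Longrightarrow> p \<in> lcarrier L"
  by (simp add: atoms_def)

lemma atom_le_atom: "p \<in> atoms L \<Longrightarrow> q \<in> atoms L \<Longrightarrow> lle L p q \<longleftrightarrow> p = q"
  using lle_refl by (auto simp: atoms_def)

end

lemma
  assumes "complete_lat L"
  shows ltop_carrier: "ltop L \<in> lcarrier L"
    and ltop_greatest: "x \<in> lcarrier L \<Longrightarrow> lle L x (ltop L)"
    and coatoms_carrier: "c \<in> coatoms L \<Longrightarrow> c \<in> lcarrier L"
    and atoms_below_ltop: "atoms_below L (ltop L) = atoms L"
    and coatoms_above_lbot: "coatoms_above L (lbot L) = coatoms L"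
proof -
  note d = complete_lat_dual[OF assms]
  show 1: "ltop L \<in> lcarrier L"
    and 2: "x \<in> lcarrier L \<Longrightarrow> lle L x (ltop L)"
    and 3: "c \<in> coatoms L \<Longrightarrow> c \<in> lcarrier L" for x c
    using lbot_carrier[OF d] lbot_least[OF d] atoms_carrier[OF d] by simp_all
  show "atoms_below L (ltop L) = atoms L" "coatoms_above L (lbot L) = coatoms L"
    using 2 3 atoms_carrier[OF assms] lbot_least[OF assms]
    by (auto simp: atoms_below_def coatoms_above_def)
qed

section \<open>Objects and arrows in terms of atoms\<close>

lemma cal0sym_obj_dual: "cal0sym_obj L \<Longrightarrow> cal0sym_obj (dual_lat L)"
  unfolding cal0sym_obj_def
  by (auto simp: complete_lat_dual atomistic_def coatomistic_def Join_dual Meet_dual)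

lemma cal0sym_complete: "cal0sym_obj L \<Longrightarrow> complete_lat L"
  by (simp add: cal0sym_obj_def)

text \<open>The top is included because the adjoint of an arrow may send a coatom to 1: the full set
  of atoms is an admissible preimage, and an admissible fibre in \<open>tsr_gen\<close>.\<close>

definition coatomic_sets :: "'a lat \<Rightarrow> 'a set set" where
  "coatomic_sets L = Cl L (coatoms L \<union> {ltop L})"

context
  fixes L :: "'a lat"
  assumes L: "cal0sym_obj L"
begin

private lemmas C = cal0sym_complete[OF L]

lemma atomic_decomp: "x \<in> lcarrier L \<Longrightarrow> Join L (atoms_below L x) = x"
  using L by (simp add: cal0sym_obj_def atomistic_def)

lemma atoms_below_carrier: "atoms_below L x \<subseteq> lcarrier L"
  using atoms_carrier[OF C] by (auto simp: atoms_below_def)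

lemma le_iff_atoms_below:
  assumes "x \<in> lcarrier L" "y \<in> lcarrier L"
  shows "lle L x y \<longleftrightarrow> atoms_below L x \<subseteq> atoms_below L y"
proof
  show "lle L x y \<Longrightarrow> atoms_below L x \<subseteq> atoms_below L y"
    using assms lle_trans[OF C] atoms_carrier[OF C] by (auto simp: atoms_below_def)
next
  assume "atoms_below L x \<subseteq> atoms_below L y"
  then show "lle L x y"
    using Join_le_iff[OF C atoms_below_carrier, of y x] assms
    by (simp add: atomic_decomp) (auto simp: atoms_below_def)
qed

lemma coatomic_sets_iff:
  "S \<in> coatomic_sets L \<longleftrightarrow> S = atoms L \<or> (\<exists>c\<in>coatoms L. S = atoms_below L c)"
  using atoms_below_ltop[OF C] by (auto simp: coatomic_sets_def Cl_def)

lemma coatomic_setsE: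
  assumes "S \<in> coatomic_sets L"
  obtains d where "d \<in> coatoms L \<union> {ltop L}" "d \<in> lcarrier L" "S = atoms_below L d"
  using assms coatoms_carrier[OF C] ltop_carrier[OF C] by (auto simp: coatomic_sets_def Cl_def)

text \<open>Written as a comprehension to match fibres whose defining condition has become
  trivial.\<close>

lemma atoms_coatomic: "{p \<in> atoms L. True} \<in> coatomic_sets L"
  by (simp add: coatomic_sets_iff)

lemma coatom_coatomic: "c \<in> coatoms L \<Longrightarrow> {p \<in> atoms L. lle L p c} \<in> coatomic_sets L"
  by (auto simp: coatomic_sets_iff atoms_below_def)

lemma coatoms_separate_atoms:
  "\<exists>p\<in>atoms L. \<not> lle L p c \<and> \<not> lle L p d" if "c \<in> coatoms L" "d \<in> coatoms L"
  using L that unfolding cal0sym_obj_def atoms_below_def by blast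

text \<open>\<open>y\<close> is the meet of the coatoms above it, that is, their join in the dual,
  so an \<open>x\<close> below all of them is below \<open>y\<close>.\<close>

lemma lle_coatomsI:
  assumes "x \<in> lcarrier L" "y \<in> lcarrier L"
    and "\<And>c. c \<in> coatoms L \<Longrightarrow> lle L y c \<Longrightarrow> lle L x c"
  shows "lle L x y"
proof -
  note D = complete_lat_dual[OF C]
  have "y = Join (dual_lat L) (coatoms_above L y)"
    using L assms(2) by (simp add: cal0sym_obj_def coatomistic_def Join_dual)
  moreover have "lle (dual_lat L) (Join (dual_lat L) (coatoms_above L y)) x"
    using assms coatoms_carrier[OF C] by (subst Join_le_iff[OF D]) (auto simp: coatoms_above_def)
  ultimately show ?thesis by simp
qed

lemma coatoms_eqI:
  assumes "x \<in> lcarrier L" "y \<in> lcarrier L"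
    and "\<And>c. c \<in> coatoms L \<Longrightarrow> lle L x c \<longleftrightarrow> lle L y c"
  shows "x = y"
  using lle_coatomsI[of x y] lle_coatomsI[of y x] lle_antisym[OF C] assms by blast

lemma atoms_below_inj: "x \<in> lcarrier L \<Longrightarrow> y \<in> lcarrier L \<Longrightarrow> atoms_below L x = atoms_below L y \<Longrightarrow> x = y"
  by (metis atomic_decomp)

lemma coatom_maximal:
  assumes "c \<in> coatoms L" "d \<in> coatoms L" "atoms_below L c \<subseteq> atoms_below L d"
  shows "c = d"
  using assms le_iff_atoms_below[of c d] atom_le_atom[OF complete_lat_dual[OF C]] coatoms_carrier[OF C]
  by auto

end

lemma coatomic_sets_dual_iff:
  assumes "cal0sym_obj L"
  shows "S \<in> coatomic_sets (dual_lat L) \<longleftrightarrow> S = coatoms L \<or> (\<exists>p\<in>atoms L. S = coatoms_above L p)"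
  using coatomic_sets_iff[OF cal0sym_obj_dual[OF assms]] by simp

lemma atoms_separate_coatoms:
  "cal0sym_obj L \<Longrightarrow> p \<in> atoms L \<Longrightarrow> q \<in> atoms L \<Longrightarrow> \<exists>c\<in>coatoms L. \<not> lle L p c \<and> \<not> lle L q c"
  using coatoms_separate_atoms[OF cal0sym_obj_dual, of L] by simp

text \<open>If every coatom above \<open>q\<close> were above \<open>p\<close>, then
  \<open>p\<close> would lie below \<open>q\<close>, and comparable atoms are equal.\<close>

lemma coatom_between_atoms:
  assumes "cal0sym_obj L" "p \<in> atoms L" "q \<in> atoms L" "p \<noteq> q"
  shows "\<exists>c\<in>coatoms L. lle L q c \<and> \<not> lle L p c"
  using assms lle_coatomsI[of L p q] atom_le_atom[of L] by (metis atoms_carrier cal0sym_complete)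

section \<open>Arrows: adjoints, preimages of coatomic sets, composition\<close>

lemma HomD:
  assumes "f \<in> Hom L M"
  shows "f \<in> extensional (lcarrier L)" "x \<in> lcarrier L \<Longrightarrow> f x \<in> lcarrier M"
    "A \<subseteq> lcarrier L \<Longrightarrow> f (Join L A) = Join M (f ` A)"
    "p \<in> atoms L \<Longrightarrow> f p \<in> atoms M \<union> {lbot M}"
  using assms by (auto simp: Hom_def)

lemma Hom_lbot: "f \<in> Hom L M \<Longrightarrow> f (lbot L) = lbot M"
  using HomD(3)[of f L M "{}"] by (simp add: lbot_def)

lemma Hom_eqI:
  assumes L: "cal0sym_obj L" and f: "f \<in> Hom L M" and g: "g \<in> Hom L M"
    and eq: "\<And>p. p \<in> atoms L \<Longrightarrow> f p = g p"
  shows "f = g"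
proof (rule extensionalityI[OF HomD(1)[OF f] HomD(1)[OF g]])
  fix x assume x: "x \<in> lcarrier L"
  have "f ` atoms_below L x = g ` atoms_below L x"
    using eq by (auto simp: atoms_below_def image_def)
  then show "f x = g x"
    using HomD(3)[OF f atoms_below_carrier[OF L], of x] HomD(3)[OF g atoms_below_carrier[OF L], of x] x
    by (simp add: atomic_decomp[OF L])
qed

text \<open>The set whose join is \<open>adj L M f c\<close> contains that join, because
  \<open>f\<close> sends it to a join of elements below \<open>c\<close>. Monotonicity of
  \<open>f\<close> comes from preservation of the join of \<open>x\<close> and
  \<open>adj L M f c\<close>.\<close>

lemma Hom_adjoint:
  assumes L: "complete_lat L" and M: "complete_lat M" and f: "f \<in> Hom L M"
    and x: "x \<in> lcarrier L" and c: "c \<in> lcarrier M"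
  shows "lle M (f x) c \<longleftrightarrow> lle L x (adj L M f c)"
proof
  let ?A = "{a \<in> lcarrier L. lle M (f a) c}"
  have A: "?A \<subseteq> lcarrier L" and fA: "f ` ?A \<subseteq> lcarrier M"
    using HomD(2)[OF f] by auto
  show "lle M (f x) c \<Longrightarrow> lle L x (adj L M f c)"
    using x Join_upper[OF L A] by (auto simp: adj_def)
  assume le: "lle L x (adj L M f c)"
  have adj: "adj L M f c \<in> lcarrier L"
    using Join_carrier[OF L A] by (simp add: adj_def)
  have "is_lub L {x, adj L M f c} (adj L M f c)"
    using le adj lle_refl[OF L] by (auto simp: is_lub_def)
  then have "Join L {x, adj L M f c} = adj L M f c"
    using Join_eqI[OF L] x adj by simp
  then have "lle M (f x) (f (adj L M f c))"
    using HomD(3)[OF f, of "{x, adj L M f c}"] Join_upper[OF M, of "f ` {x, adj L M f c}" "f x"]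
      HomD(2)[OF f] x adj by auto
  moreover have "lle M (f (adj L M f c)) c"
    using HomD(3)[OF f A] Join_le_iff[OF M fA c] by (auto simp: adj_def)
  ultimately show "lle M (f x) c"
    using lle_trans[OF M] HomD(2)[OF f] x adj c by blast
qed

text \<open>The atoms below \<open>d\<close> determine it, so the hypothesis makes \<open>d\<close>
  a coatom or the top. This form lets \<open>d\<close> be an adjoint value, which may be
  either.\<close>

lemma Hom_preimage_coatomic:
  assumes L: "cal0sym_obj L" and M: "cal0sym_obj M" and f: "f \<in> Hom L M"
    and S: "{q \<in> atoms M. lle M q d} \<in> coatomic_sets M" and d: "d \<in> lcarrier M"
  shows "{p \<in> atoms L. lle M (f p) d} \<in> coatomic_sets L"
proof -
  note CL = cal0sym_complete[OF L] and CM = cal0sym_complete[OF M]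
  have *: "{p \<in> atoms L. lle M (f p) d} = atoms_below L (adj L M f d)"
    using Hom_adjoint[OF CL CM f _ d] atoms_carrier[OF CL] by (auto simp: atoms_below_def)
  obtain e where e: "e \<in> coatoms M \<union> {ltop M}" "e \<in> lcarrier M"
    "{q \<in> atoms M. lle M q d} = atoms_below M e"
    using coatomic_setsE[OF M S] .
  then have "e = d"
    using atoms_below_inj[OF M _ d] by (simp add: atoms_below_def)
  with e have "d \<in> coatoms M \<or> d = ltop M"
    by blast
  then show ?thesis
  proof
    assume "d \<in> coatoms M"
    then have "adj L M f d \<in> coatoms L \<union> {ltop L}"
      using f by (simp add: Hom_def)
    then show ?thesis
      unfolding * coatomic_sets_def Cl_def by (rule imageI)
  next
    assume "d = ltop M"
    then have "{p \<in> atoms L. lle M (f p) d} = atoms L"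
      using ltop_greatest[OF CM] HomD(2)[OF f] atoms_carrier[OF CL] by auto
    then show ?thesis by (simp add: coatomic_sets_iff[OF L])
  qed
qed

text \<open>By \<open>pre\<close>, each coatom \<open>c\<close> of \<open>M\<close> has an element
  \<open>d\<close> of \<open>L\<close> such that \<open>F x\<close> lies below \<open>c\<close>
  exactly when \<open>x\<close> lies below \<open>d\<close>. Both sides of the join equation then
  lie below the same coatoms, hence are equal as \<open>M\<close> is coatomistic, and
  \<open>d\<close> is the adjoint value demanded by \<open>Hom\<close>.\<close>

lemma HomI:
  assumes L: "cal0sym_obj L" and M: "cal0sym_obj M"
    and ext: "F \<in> extensional (lcarrier L)"
    and at: "\<And>p. p \<in> atoms L \<Longrightarrow> F p \<in> atoms M \<union> {lbot M}"
    and dec: "\<And>x. x \<in> lcarrier L \<Longrightarrow> F x = Join M (F ` atoms_below L x)"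
    and pre: "\<And>c. c \<in> coatoms M \<Longrightarrow> {p \<in> atoms L. lle M (F p) c} \<in> coatomic_sets L"
  shows "F \<in> Hom L M"
proof -
  note CL = cal0sym_complete[OF L] and CM = cal0sym_complete[OF M]
  have sub: "F ` atoms_below L x \<subseteq> lcarrier M" for x
    using at atoms_carrier[OF CM] lbot_carrier[OF CM] by (fastforce simp: atoms_below_def)
  have car: "F x \<in> lcarrier M" if "x \<in> lcarrier L" for x
    using dec[OF that] Join_carrier[OF CM sub] by simp
  have "\<exists>d. d \<in> coatoms L \<union> {ltop L} \<and> d \<in> lcarrier L \<and> (\<forall>x\<in>lcarrier L. lle M (F x) c \<longleftrightarrow> lle L x d)"
    if c: "c \<in> coatoms M" for c
  proof -
    obtain d where d: "d \<in> coatoms L \<union> {ltop L}" "d \<in> lcarrier L"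
      "{p \<in> atoms L. lle M (F p) c} = atoms_below L d"
      using coatomic_setsE[OF L pre[OF c]] .
    have "lle M (F x) c \<longleftrightarrow> lle L x d" if x: "x \<in> lcarrier L" for x
      using dec[OF x] Join_le_iff[OF CM sub coatoms_carrier[OF CM c], of x]
        le_iff_atoms_below[OF L x d(2)] d(3) by (auto simp: atoms_below_def)
    with d show ?thesis by blast
  qed
  then obtain d where d: "\<And>c. c \<in> coatoms M \<Longrightarrow> d c \<in> coatoms L \<union> {ltop L}"
    "\<And>c. c \<in> coatoms M \<Longrightarrow> d c \<in> lcarrier L"
    "\<And>c x. c \<in> coatoms M \<Longrightarrow> x \<in> lcarrier L \<Longrightarrow> lle M (F x) c \<longleftrightarrow> lle L x (d c)"
    by metis
  have "F (Join L A) = Join M (F ` A)" if A: "A \<subseteq> lcarrier L" for A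
  proof (rule coatoms_eqI[OF M])
    have FA: "F ` A \<subseteq> lcarrier M" using A car by auto
    show "F (Join L A) \<in> lcarrier M" "Join M (F ` A) \<in> lcarrier M"
      using car Join_carrier[OF CL A] Join_carrier[OF CM FA] by auto
    fix c assume c: "c \<in> coatoms M"
    show "lle M (F (Join L A)) c = lle M (Join M (F ` A)) c"
      using d(3)[OF c] Join_carrier[OF CL A] Join_le_iff[OF CL A d(2)[OF c]]
        Join_le_iff[OF CM FA coatoms_carrier[OF CM c]] A by auto
  qed
  moreover have "adj L M F c \<in> coatoms L \<union> {ltop L}" if c: "c \<in> coatoms M" for c
  proof -
    have "is_lub L {a \<in> lcarrier L. lle M (F a) c} (d c)"
      using d(2,3)[OF c] lle_refl[OF CL] by (auto simp: is_lub_def)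
    then have "adj L M F c = d c"
      unfolding adj_def by (intro Join_eqI[OF CL]) auto
    then show ?thesis using d(1)[OF c] by simp
  qed
  ultimately show ?thesis
    using ext at car by (auto simp: Hom_def)
qed

lemma idA_Hom:
  assumes L: "cal0sym_obj L" shows "idA L \<in> Hom L L"
proof (rule HomI[OF L L])
  show "idA L \<in> extensional (lcarrier L)"
    by (simp add: idA_def)
  fix x assume "x \<in> lcarrier L"
  moreover have "idA L ` atoms_below L x = atoms_below L x"
    using atoms_below_carrier[OF L] by (force simp: idA_def)
  ultimately show "idA L x = Join L (idA L ` atoms_below L x)"
    by (simp add: atomic_decomp[OF L]) (simp add: idA_def)
next
  fix p assume "p \<in> atoms L"
  then show "idA L p \<in> atoms L \<union> {lbot L}"
    by (simp add: idA_def atoms_carrier[OF cal0sym_complete[OF L]])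
next
  fix c assume "c \<in> coatoms L"
  then have "{p \<in> atoms L. lle L p c} \<in> coatomic_sets L"
    by (rule coatom_coatomic[OF L])
  also have "{p \<in> atoms L. lle L p c} = {p \<in> atoms L. lle L (idA L p) c}"
    by (auto simp: idA_def atoms_carrier[OF cal0sym_complete[OF L]])
  finally show "{p \<in> atoms L. lle L (idA L p) c} \<in> coatomic_sets L" .
qed

lemma compose_Hom:
  assumes L: "cal0sym_obj L" and M: "cal0sym_obj M" and N: "cal0sym_obj N"
    and f: "f \<in> Hom L M" and g: "g \<in> Hom M N"
  shows "compose (lcarrier L) g f \<in> Hom L N"
proof -
  note CL = cal0sym_complete[OF L] and CM = cal0sym_complete[OF M] and CN = cal0sym_complete[OF N]
  show ?thesis
  proof (rule HomI[OF L N])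
    show "compose (lcarrier L) g f \<in> extensional (lcarrier L)"
      by (simp add: compose_def)
    fix p assume "p \<in> atoms L"
    then show "compose (lcarrier L) g f p \<in> atoms N \<union> {lbot N}"
      using HomD(4)[OF f, of p] HomD(4)[OF g, of "f p"] Hom_lbot[OF g]
      by (auto simp: compose_def atoms_carrier[OF CL])
  next
    fix x assume x: "x \<in> lcarrier L"
    have "f ` atoms_below L x \<subseteq> lcarrier M"
      using HomD(2)[OF f] atoms_below_carrier[OF L] by blast
    moreover have "compose (lcarrier L) g f ` atoms_below L x = g ` f ` atoms_below L x"
      using atoms_below_carrier[OF L] by (force simp: compose_def image_def)
    ultimately show "compose (lcarrier L) g f x = Join N (compose (lcarrier L) g f ` atoms_below L x)"
      using HomD(3)[OF f atoms_below_carrier[OF L], of x] HomD(3)[OF g, of "f ` atoms_below L x"] x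
      by (simp add: atomic_decomp[OF L]) (simp add: compose_def)
  next
    fix c assume c: "c \<in> coatoms N"
    have cN: "c \<in> lcarrier N" by (rule coatoms_carrier[OF CN c])
    have d: "adj M N g c \<in> lcarrier M"
      unfolding adj_def by (rule Join_carrier[OF CM]) auto
    have "{q \<in> atoms M. lle N (g q) c} \<in> coatomic_sets M"
      by (rule Hom_preimage_coatomic[OF M N g coatom_coatomic[OF N c] cN])
    \<comment> \<open>By adjointness the preimage under \<open>g\<close> consists of the atoms below
      a single element of \<open>M\<close>, and this element can be pulled back along
      \<open>f\<close>.\<close>
    also have "{q \<in> atoms M. lle N (g q) c} = {q \<in> atoms M. lle M q (adj M N g c)}"
      using Hom_adjoint[OF CM CN g _ cN] atoms_carrier[OF CM] by auto
    finally have "{p \<in> atoms L. lle M (f p) (adj M N g c)} \<in> coatomic_sets L"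
      by (rule Hom_preimage_coatomic[OF L M f _ d])
    also have "{p \<in> atoms L. lle M (f p) (adj M N g c)} = {p \<in> atoms L. lle N (compose (lcarrier L) g f p) c}"
      using Hom_adjoint[OF CM CN g _ cN] HomD(2)[OF f] atoms_carrier[OF CL] by (auto simp: compose_def)
    finally show "{p \<in> atoms L. lle N (compose (lcarrier L) g f p) c} \<in> coatomic_sets L" .
  qed
qed

section \<open>Extending maps from atoms; criteria for isomorphisms\<close>

definition atom_extension :: "'a lat \<Rightarrow> 'b lat \<Rightarrow> ('a \<Rightarrow> 'b) \<Rightarrow> 'a \<Rightarrow> 'b" where
  "atom_extension L M \<phi> = restrict (\<lambda>x. Join M (\<phi> ` atoms_below L x)) (lcarrier L)"

lemma atom_extension_atom:
  assumes L: "cal0sym_obj L" and M: "cal0sym_obj M" and p: "p \<in> atoms L" and m: "\<phi> p \<in> lcarrier M"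
  shows "atom_extension L M \<phi> p = \<phi> p"
proof -
  note CL = cal0sym_complete[OF L] and CM = cal0sym_complete[OF M]
  have "atoms_below L p = {p}"
    using atom_le_atom[OF CL _ p] p by (auto simp: atoms_below_def)
  moreover have "Join M {\<phi> p} = \<phi> p"
    by (rule Join_eqI[OF CM]) (use m lle_refl[OF CM] in \<open>auto simp: is_lub_def\<close>)
  ultimately show ?thesis
    by (simp add: atom_extension_def atoms_carrier[OF CL p])
qed

lemma atom_extension_Hom:
  assumes L: "cal0sym_obj L" and M: "cal0sym_obj M"
    and at: "\<And>p. p \<in> atoms L \<Longrightarrow> \<phi> p \<in> atoms M \<union> {lbot M}"
    and pre: "\<And>c. c \<in> coatoms M \<Longrightarrow> {p \<in> atoms L. lle M (\<phi> p) c} \<in> coatomic_sets L"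
  shows "atom_extension L M \<phi> \<in> Hom L M"
    and "p \<in> atoms L \<Longrightarrow> atom_extension L M \<phi> p = \<phi> p"
proof -
  note CL = cal0sym_complete[OF L] and CM = cal0sym_complete[OF M]
  have val: "atom_extension L M \<phi> p = \<phi> p" if "p \<in> atoms L" for p
    using at[OF that] atoms_carrier[OF CM] lbot_carrier[OF CM] that
    by (intro atom_extension_atom[OF L M]) auto
  then show "p \<in> atoms L \<Longrightarrow> atom_extension L M \<phi> p = \<phi> p" .
  show "atom_extension L M \<phi> \<in> Hom L M"
  proof (rule HomI[OF L M])
    fix x assume x: "x \<in> lcarrier L"
    have "atom_extension L M \<phi> ` atoms_below L x = \<phi> ` atoms_below L x"
      using val by (auto simp: atoms_below_def image_def)
    then show "atom_extension L M \<phi> x = Join M (atom_extension L M \<phi> ` atoms_below L x)"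
      using x by simp (simp add: atom_extension_def)
  next
    fix c assume "c \<in> coatoms M"
    moreover have "{p \<in> atoms L. lle M (atom_extension L M \<phi> p) c} = {p \<in> atoms L. lle M (\<phi> p) c}"
      using val by auto
    ultimately show "{p \<in> atoms L. lle M (atom_extension L M \<phi> p) c} \<in> coatomic_sets L"
      using pre by simp
  qed (use val at in \<open>auto simp: atom_extension_def\<close>)
qed

lemma isoI:
  assumes L: "cal0sym_obj L" and M: "cal0sym_obj M" and f: "f \<in> Hom L M" and g: "g \<in> Hom M L"
    and gf: "\<And>p. p \<in> atoms L \<Longrightarrow> g (f p) = p" and fg: "\<And>q. q \<in> atoms M \<Longrightarrow> f (g q) = q"
  shows "iso L M f"
proof -
  have "compose (lcarrier L) g f = idA L"
    by (rule Hom_eqI[OF L compose_Hom[OF L M L f g] idA_Hom[OF L]])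
      (simp add: gf compose_def idA_def atoms_carrier[OF cal0sym_complete[OF L]])
  moreover have "compose (lcarrier M) f g = idA M"
    by (rule Hom_eqI[OF M compose_Hom[OF M L M g f] idA_Hom[OF M]])
      (simp add: fg compose_def idA_def atoms_carrier[OF cal0sym_complete[OF M]])
  ultimately show ?thesis
    using f g by (auto simp: iso_def)
qed

text \<open>An arrow that is bijective on atoms need not have an arrow as inverse. The condition
  \<open>im\<close> is the preimage condition for the inverse map, whose preimages are images under
  \<open>f\<close>.\<close>

lemma iso_if_bij_atoms:
  assumes L: "cal0sym_obj L" and M: "cal0sym_obj M" and f: "f \<in> Hom L M"
    and bij: "bij_betw f (atoms L) (atoms M)"
    and im: "\<And>c. c \<in> coatoms L \<Longrightarrow> f ` {p \<in> atoms L. lle L p c} \<in> coatomic_sets M"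
  shows "iso L M f"
proof -
  let ?h = "inv_into (atoms L) f"
  have h: "?h q \<in> atoms L" "f (?h q) = q" if "q \<in> atoms M" for q
    using that bij by (auto simp: bij_betw_def inv_into_into f_inv_into_f)
  have hf: "?h (f p) = p" "f p \<in> atoms M" if "p \<in> atoms L" for p
    using that bij by (auto simp: bij_betw_def)
  have "{q \<in> atoms M. lle L (?h q) c} = f ` {p \<in> atoms L. lle L p c}" for c
  proof (intro equalityI subsetI)
    fix q assume "q \<in> {q \<in> atoms M. lle L (?h q) c}"
    then show "q \<in> f ` {p \<in> atoms L. lle L p c}"
      using h[of q] by (intro image_eqI[of _ _ "?h q"]) auto
  qed (use hf in auto)
  then have "{q \<in> atoms M. lle L (?h q) c} \<in> coatomic_sets M" if "c \<in> coatoms L" for c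
    using im[OF that] by simp
  then show ?thesis
    using atom_extension_Hom[OF M L, of ?h] h hf by (intro isoI[OF L M f]) auto
qed

section \<open>The tensor product of two objects\<close>

text \<open>The fibre condition of \<open>tsr_gen\<close> without properness, so that the full
  relation, which is the top, can satisfy it too. Both atoms are quantified jointly as in
  \<open>tsr_gen\<close>, hence it is vacuous if one factor has no atoms.\<close>

definition fibrewise_coatomic :: "'a lat \<Rightarrow> 'b lat \<Rightarrow> ('a \<times> 'b) set \<Rightarrow> bool" where
  "fibrewise_coatomic L1 L2 R \<longleftrightarrow> (\<forall>p1\<in>atoms L1. \<forall>p2\<in>atoms L2.
     {q1 \<in> atoms L1. (q1, p2) \<in> R} \<in> coatomic_sets L1 \<and>
     {q2 \<in> atoms L2. (p1, q2) \<in> R} \<in> coatomic_sets L2)"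

lemma tsr_gen_iff:
  "R \<in> tsr_gen L1 L2 \<longleftrightarrow> R \<subset> atoms L1 \<times> atoms L2 \<and> fibrewise_coatomic L1 L2 R"
proof (cases "R \<subset> atoms L1 \<times> atoms L2")
  case True
  then have "{q1. (q1, p2) \<in> R} = {q1 \<in> atoms L1. (q1, p2) \<in> R}"
    "{q2. (p1, q2) \<in> R} = {q2 \<in> atoms L2. (p1, q2) \<in> R}" for p1 p2
    by auto
  then show ?thesis
    unfolding tsr_gen_def fibrewise_coatomic_def coatomic_sets_def by simp
next
  case False
  then show ?thesis by (simp add: tsr_gen_def)
qed

text \<open>An intersection of generators is a set from which every outside pair is separated by a
  generator containing the set. This removes the family \<omega> from all later arguments.\<close>

lemma tensor_carrier_iff:
  "X \<in> lcarrier (tensor L1 L2) \<longleftrightarrow> X \<subseteq> atoms L1 \<times> atoms L2 \<and>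
     (\<forall>z \<in> atoms L1 \<times> atoms L2 - X. \<exists>R\<in>tsr_gen L1 L2. X \<subseteq> R \<and> z \<notin> R)"
  (is "_ \<longleftrightarrow> ?r")
proof
  assume "X \<in> lcarrier (tensor L1 L2)"
  then obtain \<omega> where \<omega>: "\<omega> \<subseteq> tsr_gen L1 L2 \<union> {atoms L1 \<times> atoms L2}"
    "X = (atoms L1 \<times> atoms L2) \<inter> \<Inter>\<omega>"
    by (auto simp: tensor_def)
  have "\<exists>R\<in>tsr_gen L1 L2. X \<subseteq> R \<and> z \<notin> R" if "z \<in> atoms L1 \<times> atoms L2 - X" for z
  proof -
    from that \<omega>(2) obtain R where R: "R \<in> \<omega>" "z \<notin> R"
      by blast
    with \<omega>(1) that have "R \<in> tsr_gen L1 L2"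
      by blast
    with R \<omega>(2) show ?thesis
      by blast
  qed
  then show ?r
    using \<omega>(2) by blast
next
  assume r: ?r
  then have "X = (atoms L1 \<times> atoms L2) \<inter> \<Inter>{R \<in> tsr_gen L1 L2. X \<subseteq> R}"
    by blast
  then show "X \<in> lcarrier (tensor L1 L2)"
    unfolding tensor_def by (simp, intro exI conjI, assumption) blast
qed

lemma lle_tensor [simp]: "lle (tensor L1 L2) X Y \<longleftrightarrow> X \<subseteq> Y"
  by (simp add: tensor_def)

lemma complete_lat_tensor: "complete_lat (tensor L1 L2)"
proof -
  let ?T = "tensor L1 L2"
  \<comment> \<open>The join is the intersection of all generators containing the union, cut down to
    pairs of atoms because there may be no such generator.\<close>
  have "is_lub ?T A ((atoms L1 \<times> atoms L2) \<inter> \<Inter>{R \<in> tsr_gen L1 L2. \<Union>A \<subseteq> R})"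
    (is "is_lub _ _ ?J") if "A \<subseteq> lcarrier ?T" for A
  proof -
    have A: "\<Union>A \<subseteq> atoms L1 \<times> atoms L2"
      using that by (auto simp: tensor_carrier_iff subset_iff)
    have "?J \<in> lcarrier ?T"
      unfolding tensor_carrier_iff by blast
    moreover have "?J \<subseteq> Y" if Y: "Y \<in> lcarrier ?T" "\<forall>a\<in>A. a \<subseteq> Y" for Y
    proof
      fix z assume "z \<in> ?J"
      with Y show "z \<in> Y"
        unfolding tensor_carrier_iff by (smt (verit) DiffI IntD1 IntD2 InterD Sup_least mem_Collect_eq subset_trans)
    qed
    ultimately show ?thesis
      using A by (auto simp: is_lub_def)
  qed
  then show ?thesis
    unfolding complete_lat_def by auto
qed

lemma fibrewise_coatomic_full:
  assumes "cal0sym_obj L1" "cal0sym_obj L2"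
  shows "fibrewise_coatomic L1 L2 (atoms L1 \<times> atoms L2)"
  using assms by (simp add: fibrewise_coatomic_def coatomic_sets_iff)

lemma tensor_full_carrier: "atoms L1 \<times> atoms L2 \<in> lcarrier (tensor L1 L2)"
  by (simp add: tensor_carrier_iff)

lemma ltop_tensor: "ltop (tensor L1 L2) = atoms L1 \<times> atoms L2"
proof -
  have "Join (dual_lat (tensor L1 L2)) {} = atoms L1 \<times> atoms L2"
    by (rule Join_eqI[OF complete_lat_dual[OF complete_lat_tensor]])
      (use tensor_full_carrier[of L1 L2] in \<open>auto simp: is_lub_def, auto simp: tensor_carrier_iff subset_iff\<close>)
  then show ?thesis
    by (simp add: ltop_def Meet_def)
qed

text \<open>The atom \<open>p\<close> rules out the full set, so both sets come from coatoms, and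
  coatoms are pairwise incomparable.\<close>

lemma coatomic_fibre_maximal:
  assumes L: "cal0sym_obj L" and "S \<in> coatomic_sets L" "S' \<in> coatomic_sets L"
    "S \<subseteq> S'" "p \<in> atoms L" "p \<notin> S'"
  shows "S = S'"
proof -
  obtain c d where "c \<in> coatoms L" "S = atoms_below L c" "d \<in> coatoms L" "S' = atoms_below L d"
    using assms by (metis coatomic_sets_iff[OF L] subsetD)
  then show ?thesis
    using coatom_maximal[OF L] assms(4) by metis
qed

text \<open>Neither set is full, so both come from coatoms, and two coatoms do not cover the atoms.
  This is how that axiom enters the study of relations.\<close>

lemma coatomic_sets_separate:
  assumes L: "cal0sym_obj L" and "S \<in> coatomic_sets L" "S' \<in> coatomic_sets L"
    "p \<in> atoms L" "p \<notin> S" "q \<in> atoms L" "q \<notin> S'"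
  shows "\<exists>r\<in>atoms L. r \<notin> S \<and> r \<notin> S'"
proof -
  obtain c d where "c \<in> coatoms L" "S = atoms_below L c" "d \<in> coatoms L" "S' = atoms_below L d"
    using assms by (metis coatomic_sets_iff[OF L])
  then show ?thesis
    using coatoms_separate_atoms[OF L, of c d] by (auto simp: atoms_below_def)
qed

section \<open>Generators, atoms and coatoms of the tensor product\<close>

context
  fixes L1 :: "'a lat" and L2 :: "'b lat"
  assumes L1: "cal0sym_obj L1" and L2: "cal0sym_obj L2"
begin

text \<open>Each fibre is the full set or the atoms below \<open>c\<close> or \<open>d\<close>, and
  the complement is a nonempty rectangle. These boxes supply the generators that separate atoms of
  the tensor product.\<close>

lemma coatom_box_in_tsr_gen:
  assumes c: "c \<in> coatoms L1" and d: "d \<in> coatoms L2"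
  shows "{(p, q) \<in> atoms L1 \<times> atoms L2. lle L1 p c \<or> lle L2 q d} \<in> tsr_gen L1 L2" (is "?R \<in> _")
proof -
  obtain p q where "p \<in> atoms L1" "\<not> lle L1 p c" "q \<in> atoms L2" "\<not> lle L2 q d"
    using coatoms_separate_atoms[OF L1 c c] coatoms_separate_atoms[OF L2 d d] by blast
  then have "(p, q) \<in> atoms L1 \<times> atoms L2" "(p, q) \<notin> ?R"
    by simp_all
  then have "?R \<subset> atoms L1 \<times> atoms L2"
    by blast
  moreover have "{q1 \<in> atoms L1. lle L1 q1 c \<or> b} \<in> coatomic_sets L1"
    "{q2 \<in> atoms L2. b \<or> lle L2 q2 d} \<in> coatomic_sets L2" for b
    using coatom_coatomic[OF L1 c] coatom_coatomic[OF L2 d] atoms_coatomic[OF L1] atoms_coatomic[OF L2]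
    by (cases b; simp)+
  ultimately show ?thesis
    by (simp add: tsr_gen_iff fibrewise_coatomic_def)
qed

text \<open>
  If \<open>(s, p)\<close> lies in \<open>R'\<close> but not in \<open>R\<close> and \<open>(a, b)\<close> lies outside \<open>R'\<close>, pick an atom \<open>r\<close> outside both the
  fibre of \<open>R\<close> over \<open>p\<close> and the fibre of \<open>R'\<close> over \<open>b\<close>. The fibres of \<open>R\<close> and \<open>R'\<close> at \<open>r\<close>, and then those
  over \<open>p\<close>, are proper and nested, hence equal.
\<close>

lemma tsr_gen_maximal:
  assumes R: "R \<in> tsr_gen L1 L2" and R': "R' \<in> tsr_gen L1 L2" and sub: "R \<subseteq> R'"
  shows "R = R'"
proof (rule ccontr)
  assume "R \<noteq> R'"
  have fib: "fibrewise_coatomic L1 L2 R" "fibrewise_coatomic L1 L2 R'"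
    and carr: "R' \<subset> atoms L1 \<times> atoms L2"
    using R R' by (auto simp: tsr_gen_iff)
  obtain s p where s: "(s, p) \<in> R'" "(s, p) \<notin> R" "s \<in> atoms L1" "p \<in> atoms L2"
    using \<open>R \<noteq> R'\<close> sub carr by auto
  obtain a b where a: "(a, b) \<notin> R'" "a \<in> atoms L1" "b \<in> atoms L2"
    using carr by auto
  have fibre1: "{q1 \<in> atoms L1. (q1, p2) \<in> R} \<in> coatomic_sets L1"
    "{q1 \<in> atoms L1. (q1, p2) \<in> R'} \<in> coatomic_sets L1" if "p2 \<in> atoms L2" for p2
    using fib a that by (auto simp: fibrewise_coatomic_def)
  have fibre2: "{q2 \<in> atoms L2. (p1, q2) \<in> R} \<in> coatomic_sets L2"
    "{q2 \<in> atoms L2. (p1, q2) \<in> R'} \<in> coatomic_sets L2" if "p1 \<in> atoms L1" for p1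
    using fib a that by (auto simp: fibrewise_coatomic_def)
  obtain r where r: "r \<in> atoms L1" "(r, p) \<notin> R" "(r, b) \<notin> R'"
    using coatomic_sets_separate[OF L1 fibre1(1)[OF s(4)] fibre1(2)[OF a(3)], of s a] s a by auto
  have "{q2 \<in> atoms L2. (r, q2) \<in> R} = {q2 \<in> atoms L2. (r, q2) \<in> R'}"
    by (rule coatomic_fibre_maximal[OF L2 fibre2[OF r(1)], of b]) (use sub r a in auto)
  then have "(r, p) \<notin> R'"
    using r s by auto
  have "{q1 \<in> atoms L1. (q1, p) \<in> R} = {q1 \<in> atoms L1. (q1, p) \<in> R'}"
    by (rule coatomic_fibre_maximal[OF L1 fibre1[OF s(4)], of r]) (use sub r \<open>(r, p) \<notin> R'\<close> in auto)
  then show False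
    using s by auto
qed

text \<open>A box misses \<open>w\<close> if both of its coatoms miss the coordinates of
  \<open>w\<close>. To contain \<open>z\<close>, the coatom in a coordinate where \<open>z\<close>
  and \<open>w\<close> differ is chosen above that coordinate of \<open>z\<close>. Allowing
  \<open>X\<close> to be empty places the bottom and the singletons in the carrier by one
  argument.\<close>

lemma tensor_separating:
  assumes "X \<subseteq> {z}" "z \<in> atoms L1 \<times> atoms L2" "w \<in> atoms L1 \<times> atoms L2" "w \<notin> X"
  shows "\<exists>R\<in>tsr_gen L1 L2. X \<subseteq> R \<and> w \<notin> R"
proof -
  obtain p q where w: "w = (p, q)" "p \<in> atoms L1" "q \<in> atoms L2"
    using assms(3) by auto
  obtain c d where c: "c \<in> coatoms L1" "\<not> lle L1 p c" and d: "d \<in> coatoms L2" "\<not> lle L2 q d"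
    using atoms_separate_coatoms[OF L1 w(2) w(2)] atoms_separate_coatoms[OF L2 w(3) w(3)] by blast
  show ?thesis
  proof (cases "X = {}")
    case True
    with c d w show ?thesis by (intro bexI[OF _ coatom_box_in_tsr_gen[OF c(1) d(1)]]) simp
  next
    case False
    obtain p' q' where z: "z = (p', q')" "p' \<in> atoms L1" "q' \<in> atoms L2"
      using assms(2) by auto
    from False assms(1) have X: "X = {(p', q')}" using z by auto
    with assms(4) w consider "p \<noteq> p'" | "q \<noteq> q'" by auto
    then show ?thesis
    proof cases
      case 1
      then obtain c' where c': "c' \<in> coatoms L1" "lle L1 p' c'" "\<not> lle L1 p c'"
        using coatom_between_atoms[OF L1] w z by blast
      with d w z X show ?thesis by (intro bexI[OF _ coatom_box_in_tsr_gen[OF c'(1) d(1)]]) simp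
    next
      case 2
      then obtain d' where d': "d' \<in> coatoms L2" "lle L2 q' d'" "\<not> lle L2 q d'"
        using coatom_between_atoms[OF L2] w z by blast
      with c w z X show ?thesis by (intro bexI[OF _ coatom_box_in_tsr_gen[OF c(1) d'(1)]]) simp
    qed
  qed
qed

lemma singleton_tensor_carrier: "z \<in> atoms L1 \<times> atoms L2 \<Longrightarrow> {z} \<in> lcarrier (tensor L1 L2)"
  using tensor_separating[of "{z}" z] by (auto simp: tensor_carrier_iff)

lemma empty_tensor_carrier: "{} \<in> lcarrier (tensor L1 L2)"
  using tensor_separating[of "{}"] by (auto simp: tensor_carrier_iff)

lemma tsr_gen_carrier: "R \<in> tsr_gen L1 L2 \<Longrightarrow> R \<in> lcarrier (tensor L1 L2)"
  by (auto simp: tensor_carrier_iff tsr_gen_iff)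

lemma lbot_tensor: "lbot (tensor L1 L2) = {}"
  unfolding lbot_def
  by (rule Join_eqI[OF complete_lat_tensor]) (use empty_tensor_carrier in \<open>auto simp: is_lub_def\<close>)

lemma atoms_tensor: "atoms (tensor L1 L2) = (\<lambda>z. {z}) ` (atoms L1 \<times> atoms L2)" (is "_ = ?S")
proof
  show "?S \<subseteq> atoms (tensor L1 L2)"
    using singleton_tensor_carrier by (auto simp: atoms_def lbot_tensor)
  show "atoms (tensor L1 L2) \<subseteq> ?S"
  proof
    fix X assume "X \<in> atoms (tensor L1 L2)"
    then have X: "X \<subseteq> atoms L1 \<times> atoms L2" "X \<noteq> {}"
      and min: "\<And>Y. Y \<in> lcarrier (tensor L1 L2) \<Longrightarrow> Y \<subseteq> X \<Longrightarrow> Y = {} \<or> Y = X"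
      by (auto simp: atoms_def lbot_tensor tensor_carrier_iff)
    then obtain z where "z \<in> X" by blast
    with X min[OF singleton_tensor_carrier, of z] show "X \<in> ?S"
      by blast
  qed
qed

text \<open>A coatom lies in some generator by separation and so equals it. Conversely, a proper
  element above a generator lies in a second generator, and generators are incomparable by
  \<open>tsr_gen_maximal\<close>.\<close>

lemma coatoms_tensor: "coatoms (tensor L1 L2) = tsr_gen L1 L2"
proof -
  have co: "X \<in> coatoms (tensor L1 L2) \<longleftrightarrow> X \<in> lcarrier (tensor L1 L2) \<and> X \<noteq> atoms L1 \<times> atoms L2 \<and>
    (\<forall>Y\<in>lcarrier (tensor L1 L2). X \<subseteq> Y \<longrightarrow> Y = atoms L1 \<times> atoms L2 \<or> Y = X)" for X
    by (simp add: coatoms_def atoms_def ltop_tensor)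
  show ?thesis
  proof (intro equalityI subsetI)
    fix X assume "X \<in> coatoms (tensor L1 L2)"
    then have X: "X \<in> lcarrier (tensor L1 L2)" "X \<noteq> atoms L1 \<times> atoms L2"
      and max: "\<And>Y. Y \<in> lcarrier (tensor L1 L2) \<Longrightarrow> X \<subseteq> Y \<Longrightarrow> Y = atoms L1 \<times> atoms L2 \<or> Y = X"
      by (auto simp: co)
    then obtain R where "R \<in> tsr_gen L1 L2" "X \<subseteq> R"
      unfolding tensor_carrier_iff by blast
    with max[OF tsr_gen_carrier, of R] show "X \<in> tsr_gen L1 L2"
      by (auto simp: tsr_gen_iff)
  next
    fix R assume R: "R \<in> tsr_gen L1 L2"
    have "Y = atoms L1 \<times> atoms L2 \<or> Y = R" if Y: "Y \<in> lcarrier (tensor L1 L2)" "R \<subseteq> Y" for Y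
    proof (rule disjCI)
      assume "Y \<noteq> R"
      show "Y = atoms L1 \<times> atoms L2"
      proof (rule ccontr)
        assume "Y \<noteq> atoms L1 \<times> atoms L2"
        with Y obtain R' where "R' \<in> tsr_gen L1 L2" "Y \<subseteq> R'"
          unfolding tensor_carrier_iff by blast
        with tsr_gen_maximal[OF R, of R'] Y \<open>Y \<noteq> R\<close> show False by blast
      qed
    qed
    with R tsr_gen_carrier show "R \<in> coatoms (tensor L1 L2)"
      by (auto simp: co tsr_gen_iff)
  qed
qed

lemma atoms_below_tensor:
  "X \<in> lcarrier (tensor L1 L2) \<Longrightarrow> atoms_below (tensor L1 L2) X = (\<lambda>z. {z}) ` X"
  by (auto simp: atoms_below_def atoms_tensor tensor_carrier_iff)

lemma coatoms_above_tensor: "coatoms_above (tensor L1 L2) X = {R \<in> tsr_gen L1 L2. X \<subseteq> R}"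
  by (simp add: coatoms_above_def coatoms_tensor)

lemma cal0sym_obj_tensor: "cal0sym_obj (tensor L1 L2)"
proof -
  let ?T = "tensor L1 L2"
  have C: "complete_lat ?T" by (rule complete_lat_tensor)
  have "atomistic ?T"
    unfolding atomistic_def
  proof
    fix X assume X: "X \<in> lcarrier ?T"
    have "Join ?T (atoms_below ?T X) = X"
      by (rule Join_eqI[OF C])
        (use X singleton_tensor_carrier in \<open>auto simp: atoms_below_tensor is_lub_def, auto simp: tensor_carrier_iff\<close>)
    then show "X = Join ?T (atoms_below ?T X)" by simp
  qed
  moreover have "coatomistic ?T"
    unfolding coatomistic_def
  proof
    fix X assume X: "X \<in> lcarrier ?T"
    have "Y \<subseteq> X" if Y: "Y \<in> lcarrier ?T" "\<forall>R\<in>coatoms_above ?T X. Y \<subseteq> R" for Y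
    proof
      fix z assume "z \<in> Y"
      with Y(1) have "z \<in> atoms L1 \<times> atoms L2" by (auto simp: tensor_carrier_iff)
      with X Y(2) \<open>z \<in> Y\<close> show "z \<in> X"
        unfolding tensor_carrier_iff coatoms_above_tensor by blast
    qed
    then have "is_lub (dual_lat ?T) (coatoms_above ?T X) X"
      using X by (auto simp: is_lub_def coatoms_above_tensor)
    then have "Meet ?T (coatoms_above ?T X) = X"
      unfolding Meet_def using tsr_gen_carrier
      by (intro Join_eqI[OF complete_lat_dual[OF C]]) (auto simp: coatoms_above_tensor)
    then show "X = Meet ?T (coatoms_above ?T X)" by simp
  qed
  moreover have "atoms_below ?T R \<union> atoms_below ?T R' \<noteq> atoms ?T"
    if R: "R \<in> tsr_gen L1 L2" "R' \<in> tsr_gen L1 L2" for R R'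
  proof -
    have fib: "fibrewise_coatomic L1 L2 R" "fibrewise_coatomic L1 L2 R'"
      using R by (auto simp: tsr_gen_iff)
    obtain a b where a: "(a, b) \<notin> R" "a \<in> atoms L1" "b \<in> atoms L2"
      using R by (auto simp: tsr_gen_iff)
    obtain c d where c: "(c, d) \<notin> R'" "c \<in> atoms L1" "d \<in> atoms L2"
      using R by (auto simp: tsr_gen_iff)
    \<comment> \<open>One pair must be missing from both relations. Choosing \<open>e\<close>
      outside the fibre of \<open>R\<close> over \<open>b\<close> and that of \<open>R'\<close> over
      \<open>d\<close> makes both fibres at \<open>e\<close> proper, and a second choice in
      \<open>L2\<close> gives \<open>f\<close>.\<close>
    have "{q1 \<in> atoms L1. (q1, b) \<in> R} \<in> coatomic_sets L1" "{q1 \<in> atoms L1. (q1, d) \<in> R'} \<in> coatomic_sets L1"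
      using fib a c by (auto simp: fibrewise_coatomic_def)
    from coatomic_sets_separate[OF L1 this, of a c] obtain e
      where e: "e \<in> atoms L1" "(e, b) \<notin> R" "(e, d) \<notin> R'"
      using a c by auto
    have "{q2 \<in> atoms L2. (e, q2) \<in> R} \<in> coatomic_sets L2" "{q2 \<in> atoms L2. (e, q2) \<in> R'} \<in> coatomic_sets L2"
      using fib a e by (auto simp: fibrewise_coatomic_def)
    from coatomic_sets_separate[OF L2 this, of b d] obtain f
      where f: "f \<in> atoms L2" "(e, f) \<notin> R" "(e, f) \<notin> R'"
      using a c e by auto
    then have "{(e, f)} \<in> atoms ?T" "{(e, f)} \<notin> atoms_below ?T R \<union> atoms_below ?T R'"
      using e by (auto simp: atoms_tensor atoms_below_def)
    then show ?thesis by blast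
  qed
  moreover have "coatoms_above ?T P \<union> coatoms_above ?T Q \<noteq> coatoms ?T"
    if P: "P \<in> atoms ?T" "Q \<in> atoms ?T" for P Q
  proof -
    obtain p1 p2 q1 q2 where p: "P = {(p1, p2)}" "p1 \<in> atoms L1" "p2 \<in> atoms L2"
      and q: "Q = {(q1, q2)}" "q1 \<in> atoms L1" "q2 \<in> atoms L2"
      using P by (auto simp: atoms_tensor)
    obtain c where c: "c \<in> coatoms L1" "\<not> lle L1 p1 c" "\<not> lle L1 q1 c"
      using atoms_separate_coatoms[OF L1] p q by blast
    obtain d where d: "d \<in> coatoms L2" "\<not> lle L2 p2 d" "\<not> lle L2 q2 d"
      using atoms_separate_coatoms[OF L2] p q by blast
    \<comment> \<open>Since \<open>c\<close> misses both first coordinates and \<open>d\<close> both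
      second ones, this box contains neither pair.\<close>
    define R where "R = {(p, q) \<in> atoms L1 \<times> atoms L2. lle L1 p c \<or> lle L2 q d}"
    have "R \<in> coatoms ?T" "R \<notin> coatoms_above ?T P" "R \<notin> coatoms_above ?T Q"
      using coatom_box_in_tsr_gen[OF c(1) d(1)] c d p q
      by (simp_all add: R_def coatoms_tensor coatoms_above_tensor)
    then show ?thesis
      by blast
  qed
  ultimately show ?thesis
    using C by (simp add: cal0sym_obj_def coatoms_tensor)
qed

text \<open>Adding the full relation, which is the top, to \<open>tsr_gen\<close> gives exactly the
  fibrewise coatomic relations. The form with a predicate on atoms can be applied again inside a
  fibre, which resolves nested tensor products into one-variable conditions.\<close>

lemma coatomic_sets_tensor_iff:
  "{P \<in> atoms (tensor L1 L2). Q P} \<in> coatomic_sets (tensor L1 L2) \<longleftrightarrow>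
   (\<forall>p1\<in>atoms L1. \<forall>p2\<in>atoms L2. {q1 \<in> atoms L1. Q {(q1, p2)}} \<in> coatomic_sets L1 \<and>
      {q2 \<in> atoms L2. Q {(p1, q2)}} \<in> coatomic_sets L2)"
  (is "?S \<in> _ \<longleftrightarrow> ?r")
proof -
  let ?R = "{z \<in> atoms L1 \<times> atoms L2. Q {z}}"
  have S: "?S = (\<lambda>z. {z}) ` ?R"
    by (auto simp: atoms_tensor)
  have inj: "(\<lambda>z. {z}) ` A = (\<lambda>z. {z}) ` B \<longleftrightarrow> A = B" for A B :: "('a \<times> 'b) set"
    by (rule inj_image_eq_iff) simp
  have "(\<exists>c\<in>tsr_gen L1 L2. (\<lambda>z. {z}) ` ?R = atoms_below (tensor L1 L2) c) \<longleftrightarrow> ?R \<in> tsr_gen L1 L2"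
    using atoms_below_tensor[OF tsr_gen_carrier] by (simp add: inj)
  then have "?S \<in> coatomic_sets (tensor L1 L2) \<longleftrightarrow> ?R = atoms L1 \<times> atoms L2 \<or> ?R \<in> tsr_gen L1 L2"
    by (subst S) (simp only: coatomic_sets_iff[OF cal0sym_obj_tensor] coatoms_tensor atoms_tensor inj)
  also have "\<dots> \<longleftrightarrow> fibrewise_coatomic L1 L2 ?R"
    using fibrewise_coatomic_full[OF L1 L2] by (auto simp: tsr_gen_iff)
  also have "\<dots> \<longleftrightarrow> ?r"
    by (auto simp: fibrewise_coatomic_def)
  finally show ?thesis .
qed

end

text \<open>A bimorphism criterion fitted to structure maps given as joins of sets
  \<open>G X\<close> of values. Pairs outside \<open>D\<close> are omitted from \<open>G X\<close>,
  which amounts to the value 0; as 0 lies below each coatom, such pairs belong to every preimage,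
  whence the implications in \<open>pre1\<close> and \<open>pre2\<close>.\<close>

lemma tensor_HomI:
  assumes L1: "cal0sym_obj L1" and L2: "cal0sym_obj L2" and M: "cal0sym_obj M"
    and F: "F = restrict (\<lambda>X. Join M (G X)) (lcarrier (tensor L1 L2))"
    and G: "\<And>X. X \<in> lcarrier (tensor L1 L2) \<Longrightarrow> G X = {\<phi> p q |p q. (p, q) \<in> X \<and> D p q}"
    and at: "\<And>p q. p \<in> atoms L1 \<Longrightarrow> q \<in> atoms L2 \<Longrightarrow> D p q \<Longrightarrow> \<phi> p q \<in> atoms M \<union> {lbot M}"
    and pre1: "\<And>c p2. c \<in> coatoms M \<Longrightarrow> p2 \<in> atoms L2 \<Longrightarrow>
      {p1 \<in> atoms L1. D p1 p2 \<longrightarrow> lle M (\<phi> p1 p2) c} \<in> coatomic_sets L1"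
    and pre2: "\<And>c p1. c \<in> coatoms M \<Longrightarrow> p1 \<in> atoms L1 \<Longrightarrow>
      {p2 \<in> atoms L2. D p1 p2 \<longrightarrow> lle M (\<phi> p1 p2) c} \<in> coatomic_sets L2"
  shows "F \<in> Hom (tensor L1 L2) M"
    and "p \<in> atoms L1 \<Longrightarrow> q \<in> atoms L2 \<Longrightarrow> F {(p, q)} = (if D p q then \<phi> p q else lbot M)"
proof -
  note T = cal0sym_obj_tensor[OF L1 L2] and CM = cal0sym_complete[OF M]
  \<comment> \<open>Atoms of a tensor product are singletons; \<open>the_elem\<close> recovers the
    pair.\<close>
  define \<psi> where "\<psi> P = (case the_elem P of (p, q) \<Rightarrow> if D p q then \<phi> p q else lbot M)" for P
  have \<psi>: "\<psi> {(p, q)} = (if D p q then \<phi> p q else lbot M)" for p q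
    by (simp add: \<psi>_def)
  have \<psi>_at: "\<psi> P \<in> atoms M \<union> {lbot M}" if P: "P \<in> atoms (tensor L1 L2)" for P
  proof -
    obtain p q where "P = {(p, q)}" "p \<in> atoms L1" "q \<in> atoms L2"
      using P by (auto simp: atoms_tensor[OF L1 L2])
    then show ?thesis
      using at[of p q] by (simp add: \<psi>)
  qed
  have F_eq: "F = atom_extension (tensor L1 L2) M \<psi>"
    unfolding F atom_extension_def
  proof (rule restrict_ext)
    fix X assume X: "X \<in> lcarrier (tensor L1 L2)"
    then have sub: "X \<subseteq> atoms L1 \<times> atoms L2" by (simp add: tensor_carrier_iff)
    have im: "\<psi> ` atoms_below (tensor L1 L2) X = (\<lambda>(p, q). if D p q then \<phi> p q else lbot M) ` X"
      unfolding atoms_below_tensor[OF L1 L2 X] image_image by (auto simp: \<psi>_def)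
    show "Join M (G X) = Join M (\<psi> ` atoms_below (tensor L1 L2) X)"
    proof (rule Join_diff_lbot_cong[OF CM])
      show "G X \<subseteq> lcarrier M"
        using at sub atoms_carrier[OF CM] lbot_carrier[OF CM] by (fastforce simp: G[OF X])
      show "\<psi> ` atoms_below (tensor L1 L2) X \<subseteq> lcarrier M"
        using \<psi>_at atoms_carrier[OF CM] lbot_carrier[OF CM] by (fastforce simp: atoms_below_def)
      show "G X - {lbot M} = \<psi> ` atoms_below (tensor L1 L2) X - {lbot M}"
        unfolding im G[OF X] by (auto intro: rev_image_eqI split: if_splits) blast
    qed
  qed
  have "{P \<in> atoms (tensor L1 L2). lle M (\<psi> P) c} \<in> coatomic_sets (tensor L1 L2)"
    if c: "c \<in> coatoms M" for c
  proof -
    have "lle M (\<psi> {(p, q)}) c \<longleftrightarrow> (D p q \<longrightarrow> lle M (\<phi> p q) c)" for p q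
      using lbot_least[OF CM coatoms_carrier[OF CM c]] by (simp add: \<psi>)
    then show ?thesis
      using pre1[OF c] pre2[OF c] by (simp add: coatomic_sets_tensor_iff[OF L1 L2])
  qed
  note ext = atom_extension_Hom[OF T M \<psi>_at this]
  show "F \<in> Hom (tensor L1 L2) M"
    unfolding F_eq by (rule ext(1))
  show "F {(p, q)} = (if D p q then \<phi> p q else lbot M)" if "p \<in> atoms L1" "q \<in> atoms L2"
    unfolding F_eq using that by (subst ext(2)) (auto simp: atoms_tensor[OF L1 L2] \<psi>)
qed

section \<open>Tensor product of arrows, associator and symmetry\<close>

lemma tsr_gen_fibres:
  assumes "R \<in> tsr_gen L1 L2"
  shows "q \<in> atoms L2 \<Longrightarrow> {p \<in> atoms L1. (p, q) \<in> R} \<in> coatomic_sets L1"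
    and "p \<in> atoms L1 \<Longrightarrow> {q \<in> atoms L2. (p, q) \<in> R} \<in> coatomic_sets L2"
  using assms unfolding tsr_gen_iff fibrewise_coatomic_def by blast+

lemma Hom_atom_cases:
  assumes "f \<in> Hom L M" "p \<in> atoms L"
  obtains "f p = lbot M" | "f p \<in> atoms M" "f p \<noteq> lbot M"
  using HomD(4)[OF assms] by (auto simp: atoms_def)

lemma compose_atom: "cal0sym_obj L \<Longrightarrow> p \<in> atoms L \<Longrightarrow> compose (lcarrier L) g f p = g (f p)"
  by (simp add: compose_def atoms_carrier[OF cal0sym_complete])

lemma idA_atom: "cal0sym_obj L \<Longrightarrow> p \<in> atoms L \<Longrightarrow> idA L p = p"
  by (simp add: idA_def atoms_carrier[OF cal0sym_complete])

lemma atom_neq_lbot: "p \<in> atoms L \<Longrightarrow> p \<noteq> lbot L"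
  by (simp add: atoms_def)

lemma tensor_atomI:
  "cal0sym_obj L1 \<Longrightarrow> cal0sym_obj L2 \<Longrightarrow> p \<in> atoms L1 \<Longrightarrow> q \<in> atoms L2 \<Longrightarrow> {(p, q)} \<in> atoms (tensor L1 L2)"
  by (simp add: atoms_tensor)

lemma tensor_atomE:
  assumes "P \<in> atoms (tensor L1 L2)" "cal0sym_obj L1" "cal0sym_obj L2"
  obtains p q where "P = {(p, q)}" "p \<in> atoms L1" "q \<in> atoms L2"
  using assms by (auto simp: atoms_tensor)

text \<open>Here the coatomic set is a set of atoms, so 0 is not a member although it lies below
  every element; the implication admits the atoms sent to 0.\<close>

lemma Hom_preimage_coatomic_set:
  assumes L: "cal0sym_obj L" and M: "cal0sym_obj M" and f: "f \<in> Hom L M" and S: "S \<in> coatomic_sets M"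
  shows "{p \<in> atoms L. f p \<noteq> lbot M \<longrightarrow> f p \<in> S} \<in> coatomic_sets L"
proof -
  obtain d where d: "d \<in> lcarrier M" "S = atoms_below M d"
    using coatomic_setsE[OF M S] by metis
  have "{p \<in> atoms L. lle M (f p) d} \<in> coatomic_sets L"
    using Hom_preimage_coatomic[OF L M f _ d(1)] S d(2) by (simp add: atoms_below_def)
  also have "{p \<in> atoms L. lle M (f p) d} = {p \<in> atoms L. f p \<noteq> lbot M \<longrightarrow> f p \<in> S}"
    using HomD(4)[OF f] lbot_least[OF cal0sym_complete[OF M] d(1)] d(2) by (auto simp: atoms_below_def)
  finally show ?thesis .
qed

text \<open>With one coordinate fixed, either its image is 0 and the condition on the other is
  vacuous, or the fibre is the preimage, along the remaining arrow, of a fibre of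
  \<open>R\<close>.\<close>

lemma
  assumes L1: "cal0sym_obj L1" and L2: "cal0sym_obj L2" and M1: "cal0sym_obj M1" and M2: "cal0sym_obj M2"
    and f1: "f1 \<in> Hom L1 M1" and f2: "f2 \<in> Hom L2 M2"
  shows tensor_arr_Hom: "tensor_arr L1 L2 M1 M2 f1 f2 \<in> Hom (tensor L1 L2) (tensor M1 M2)"
    and tensor_arr_atom: "p \<in> atoms L1 \<Longrightarrow> q \<in> atoms L2 \<Longrightarrow> tensor_arr L1 L2 M1 M2 f1 f2 {(p, q)} =
      (if f1 p \<noteq> lbot M1 \<and> f2 q \<noteq> lbot M2 then {(f1 p, f2 q)} else {})"
proof -
  let ?D = "\<lambda>p q. f1 p \<noteq> lbot M1 \<and> f2 q \<noteq> lbot M2"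
  have at: "{(f1 p, f2 q)} \<in> atoms (tensor M1 M2) \<union> {lbot (tensor M1 M2)}"
    if "p \<in> atoms L1" "q \<in> atoms L2" "?D p q" for p q
    using that HomD(4)[OF f1, of p] HomD(4)[OF f2, of q] by (simp add: tensor_atomI[OF M1 M2])
  have pre1: "{p1 \<in> atoms L1. ?D p1 p2 \<longrightarrow> lle (tensor M1 M2) {(f1 p1, f2 p2)} R} \<in> coatomic_sets L1"
    if R: "R \<in> coatoms (tensor M1 M2)" and p2: "p2 \<in> atoms L2" for R p2
  proof (cases rule: Hom_atom_cases[OF f2 p2])
    case 1
    then show ?thesis by (simp add: atoms_coatomic[OF L1, simplified])
  next
    case 2
    have "{p1 \<in> atoms L1. f1 p1 \<noteq> lbot M1 \<longrightarrow> f1 p1 \<in> {q \<in> atoms M1. (q, f2 p2) \<in> R}} \<in> coatomic_sets L1"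
      using R 2 by (intro Hom_preimage_coatomic_set[OF L1 M1 f1] tsr_gen_fibres) (simp_all add: coatoms_tensor M1 M2)
    also have "{p1 \<in> atoms L1. f1 p1 \<noteq> lbot M1 \<longrightarrow> f1 p1 \<in> {q \<in> atoms M1. (q, f2 p2) \<in> R}} =
      {p1 \<in> atoms L1. ?D p1 p2 \<longrightarrow> lle (tensor M1 M2) {(f1 p1, f2 p2)} R}"
      using 2 HomD(4)[OF f1] by auto
    finally show ?thesis .
  qed
  have pre2: "{p2 \<in> atoms L2. ?D p1 p2 \<longrightarrow> lle (tensor M1 M2) {(f1 p1, f2 p2)} R} \<in> coatomic_sets L2"
    if R: "R \<in> coatoms (tensor M1 M2)" and p1: "p1 \<in> atoms L1" for R p1
  proof (cases rule: Hom_atom_cases[OF f1 p1])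
    case 1
    then show ?thesis by (simp add: atoms_coatomic[OF L2, simplified])
  next
    case 2
    have "{p2 \<in> atoms L2. f2 p2 \<noteq> lbot M2 \<longrightarrow> f2 p2 \<in> {q \<in> atoms M2. (f1 p1, q) \<in> R}} \<in> coatomic_sets L2"
      using R 2 by (intro Hom_preimage_coatomic_set[OF L2 M2 f2] tsr_gen_fibres) (simp_all add: coatoms_tensor M1 M2)
    also have "{p2 \<in> atoms L2. f2 p2 \<noteq> lbot M2 \<longrightarrow> f2 p2 \<in> {q \<in> atoms M2. (f1 p1, q) \<in> R}} =
      {p2 \<in> atoms L2. ?D p1 p2 \<longrightarrow> lle (tensor M1 M2) {(f1 p1, f2 p2)} R}"
      using 2 HomD(4)[OF f2] by auto
    finally show ?thesis .
  qed
  note * = tensor_HomI[OF L1 L2 cal0sym_obj_tensor[OF M1 M2] tensor_arr_def refl at pre1 pre2]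
  show "tensor_arr L1 L2 M1 M2 f1 f2 \<in> Hom (tensor L1 L2) (tensor M1 M2)"
    by (rule *(1))
  show "p \<in> atoms L1 \<Longrightarrow> q \<in> atoms L2 \<Longrightarrow> tensor_arr L1 L2 M1 M2 f1 f2 {(p, q)} =
      (if f1 p \<noteq> lbot M1 \<and> f2 q \<noteq> lbot M2 then {(f1 p, f2 q)} else {})"
    using *(2) by (simp add: lbot_tensor[OF M1 M2])
qed

lemma Hom_tensor_empty:
  "cal0sym_obj L1 \<Longrightarrow> cal0sym_obj L2 \<Longrightarrow> f \<in> Hom (tensor L1 L2) M \<Longrightarrow> f {} = lbot M"
  using Hom_lbot[of f "tensor L1 L2" M] by (simp add: lbot_tensor)

lemma tensor_Hom_eqI:
  assumes "cal0sym_obj L1" "cal0sym_obj L2" "f \<in> Hom (tensor L1 L2) M" "g \<in> Hom (tensor L1 L2) M"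
    and "\<And>p q. p \<in> atoms L1 \<Longrightarrow> q \<in> atoms L2 \<Longrightarrow> f {(p, q)} = g {(p, q)}"
  shows "f = g"
  by (rule Hom_eqI[OF cal0sym_obj_tensor[OF assms(1,2)] assms(3,4)])
    (auto elim!: tensor_atomE[OF _ assms(1,2)] simp: assms(5))

text \<open>Splitting the fibres of \<open>R\<close> in \<open>tensor L2 L3\<close> gives coatomic
  fibres in each of the three variables. Regrouped with the first two variables together, these are
  the conditions asked of the preimage.\<close>

lemma
  assumes A: "cal0sym_obj L1" "cal0sym_obj L2" "cal0sym_obj L3"
  shows assoc_Hom: "assoc L1 L2 L3 \<in> Hom (tensor (tensor L1 L2) L3) (tensor L1 (tensor L2 L3))"
    and assoc_atom: "p1 \<in> atoms L1 \<Longrightarrow> p2 \<in> atoms L2 \<Longrightarrow> p3 \<in> atoms L3 \<Longrightarrow>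
      assoc L1 L2 L3 {({(p1, p2)}, p3)} = {(p1, {(p2, p3)})}"
proof -
  note T12 = cal0sym_obj_tensor[OF A(1,2)] and T23 = cal0sym_obj_tensor[OF A(2,3)]
  note T = cal0sym_obj_tensor[OF A(1) T23]
  let ?\<phi> = "\<lambda>P p3. {(fst (the_elem P), {(snd (the_elem P), p3)})}"
  have G: "{{(p1, {(p2, p3)})} |p1 p2 p3. ({(p1, p2)}, p3) \<in> X} = {?\<phi> P p3 |P p3. (P, p3) \<in> X \<and> True}"
    if X: "X \<in> lcarrier (tensor (tensor L1 L2) L3)" for X
  proof -
    have "\<exists>p1 p2. P = {(p1, p2)}" if "(P, p3) \<in> X" for P p3
      using that X by (auto simp: tensor_carrier_iff atoms_tensor[OF A(1,2)])
    then show ?thesis by force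
  qed
  have at: "?\<phi> P p3 \<in> atoms (tensor L1 (tensor L2 L3)) \<union> {lbot (tensor L1 (tensor L2 L3))}"
    if "P \<in> atoms (tensor L1 L2)" "p3 \<in> atoms L3" for P p3
    using that by (auto elim!: tensor_atomE[OF _ A(1,2)] intro!: tensor_atomI A T23)
  have fib: "{q1 \<in> atoms L1. (q1, {(p2, p3)}) \<in> R} \<in> coatomic_sets L1"
    "{q2 \<in> atoms L2. (p1, {(q2, p3)}) \<in> R} \<in> coatomic_sets L2"
    "{q3 \<in> atoms L3. (p1, {(p2, q3)}) \<in> R} \<in> coatomic_sets L3"
    if "R \<in> coatoms (tensor L1 (tensor L2 L3))" "p1 \<in> atoms L1" "p2 \<in> atoms L2" "p3 \<in> atoms L3" for R p1 p2 p3
  proof -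
    have R: "R \<in> tsr_gen L1 (tensor L2 L3)"
      using that(1) by (simp add: coatoms_tensor[OF A(1) T23])
    show "{q1 \<in> atoms L1. (q1, {(p2, p3)}) \<in> R} \<in> coatomic_sets L1"
      by (rule tsr_gen_fibres(1)[OF R tensor_atomI[OF A(2,3) that(3,4)]])
    show "{q2 \<in> atoms L2. (p1, {(q2, p3)}) \<in> R} \<in> coatomic_sets L2"
      "{q3 \<in> atoms L3. (p1, {(p2, q3)}) \<in> R} \<in> coatomic_sets L3"
      using tsr_gen_fibres(2)[OF R that(2)] that(3,4) by (simp_all add: coatomic_sets_tensor_iff[OF A(2,3)])
  qed
  have pre1: "{P \<in> atoms (tensor L1 L2). True \<longrightarrow> lle (tensor L1 (tensor L2 L3)) (?\<phi> P p3) R} \<in> coatomic_sets (tensor L1 L2)"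
    if "R \<in> coatoms (tensor L1 (tensor L2 L3))" "p3 \<in> atoms L3" for R p3
    using fib[OF that(1) _ _ that(2)] by (simp add: coatomic_sets_tensor_iff[OF A(1,2)])
  have pre2: "{p3 \<in> atoms L3. True \<longrightarrow> lle (tensor L1 (tensor L2 L3)) (?\<phi> P p3) R} \<in> coatomic_sets L3"
    if R: "R \<in> coatoms (tensor L1 (tensor L2 L3))" and P: "P \<in> atoms (tensor L1 L2)" for R P
  proof (cases "atoms L3 = {}")
    \<comment> \<open>\<open>fib\<close> presupposes an atom of \<open>L3\<close>, and a one-element
      \<open>L3\<close> has none.\<close>
    case True
    then show ?thesis using atoms_coatomic[OF A(3)] by simp
  next
    case False
    then show ?thesis using fib(3)[OF R] P by (auto elim!: tensor_atomE[OF _ A(1,2)])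
  qed
  note * = tensor_HomI[OF T12 A(3) T assoc_def G at pre1 pre2]
  show "assoc L1 L2 L3 \<in> Hom (tensor (tensor L1 L2) L3) (tensor L1 (tensor L2 L3))"
    by (rule *(1))
  show "p1 \<in> atoms L1 \<Longrightarrow> p2 \<in> atoms L2 \<Longrightarrow> p3 \<in> atoms L3 \<Longrightarrow>
      assoc L1 L2 L3 {({(p1, p2)}, p3)} = {(p1, {(p2, p3)})}"
    by (subst *(2)) (simp_all add: tensor_atomI A)
qed

lemma swap_tsr_gen: "R \<in> tsr_gen L1 L2 \<Longrightarrow> prod.swap ` R \<in> tsr_gen L2 L1"
proof -
  assume R: "R \<in> tsr_gen L1 L2"
  have "prod.swap ` R \<subseteq> atoms L2 \<times> atoms L1"
    using R by (auto simp: tsr_gen_iff)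
  moreover have "prod.swap ` R \<noteq> atoms L2 \<times> atoms L1"
    using R inj_image_eq_iff[of prod.swap R "atoms L1 \<times> atoms L2"] by (auto simp: tsr_gen_iff product_swap)
  ultimately show ?thesis
    using R by (auto simp: tsr_gen_iff fibrewise_coatomic_def)
qed

lemma swap_tensor_carrier:
  assumes X: "X \<in> lcarrier (tensor L1 L2)" shows "prod.swap ` X \<in> lcarrier (tensor L2 L1)"
  unfolding tensor_carrier_iff
proof (intro conjI ballI)
  show "prod.swap ` X \<subseteq> atoms L2 \<times> atoms L1"
    using X by (auto simp: tensor_carrier_iff)
  fix z assume z: "z \<in> atoms L2 \<times> atoms L1 - prod.swap ` X"
  then have "prod.swap z \<in> atoms L1 \<times> atoms L2 - X"
    by (auto simp: image_iff)
  from bspec[OF conjunct2[OF X[unfolded tensor_carrier_iff]] this]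
  obtain R where R: "R \<in> tsr_gen L1 L2" "X \<subseteq> R" "prod.swap z \<notin> R"
    by blast
  then have "z \<notin> prod.swap ` R"
    by auto
  with image_mono[OF R(2)] show "\<exists>R\<in>tsr_gen L2 L1. prod.swap ` X \<subseteq> R \<and> z \<notin> R"
    by (intro bexI[OF _ swap_tsr_gen[OF R(1)]] conjI)
qed

lemma
  assumes A: "cal0sym_obj L1" "cal0sym_obj L2"
  shows symm_Hom: "symm L1 L2 \<in> Hom (tensor L1 L2) (tensor L2 L1)"
    and symm_atom: "p \<in> atoms L1 \<Longrightarrow> q \<in> atoms L2 \<Longrightarrow> symm L1 L2 {(p, q)} = {(q, p)}"
proof -
  note T = cal0sym_obj_tensor[OF A(2,1)]
  \<comment> \<open>\<open>symm\<close> is defined by an image rather than a join; since the swapped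
    set is again an element, it is the join of its atoms.\<close>
  have F: "symm L1 L2 = restrict (\<lambda>X. Join (tensor L2 L1) {{(q, p)} |p q. (p, q) \<in> X \<and> True}) (lcarrier (tensor L1 L2))"
    unfolding symm_def
  proof (rule restrict_ext)
    fix X assume "X \<in> lcarrier (tensor L1 L2)"
    note Y = swap_tensor_carrier[OF this]
    have "{{(q, p)} |p q. (p, q) \<in> X \<and> True} = atoms_below (tensor L2 L1) (prod.swap ` X)"
      unfolding atoms_below_tensor[OF A(2,1) Y] by force
    then have "Join (tensor L2 L1) {{(q, p)} |p q. (p, q) \<in> X \<and> True} = prod.swap ` X"
      using atomic_decomp[OF T Y] by simp
    then show "(\<lambda>(p, q). (q, p)) ` X = Join (tensor L2 L1) {{(q, p)} |p q. (p, q) \<in> X \<and> True}"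
      by (simp add: prod.swap_def case_prod_beta')
  qed
  note * = tensor_HomI[OF A T F refl]
  have **: "{(q, p)} \<in> atoms (tensor L2 L1) \<union> {lbot (tensor L2 L1)}" if "p \<in> atoms L1" "q \<in> atoms L2" for p q
    using that by (simp add: tensor_atomI A)
  show "symm L1 L2 \<in> Hom (tensor L1 L2) (tensor L2 L1)"
    by (rule *(1)) (use ** in \<open>simp_all add: coatoms_tensor[OF A(2,1)] tsr_gen_fibres\<close>)
  show "p \<in> atoms L1 \<Longrightarrow> q \<in> atoms L2 \<Longrightarrow> symm L1 L2 {(p, q)} = {(q, p)}"
    by (simp add: symm_def singleton_tensor_carrier[OF A])
qed

section \<open>The two-element lattice and the unit maps\<close>

lemma
  shows atoms_two [simp]: "atoms two = {True}" and coatoms_two [simp]: "coatoms two = {False}"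
    and lbot_two [simp]: "lbot two = False" and ltop_two [simp]: "ltop two = True"
    and cal0sym_obj_two: "cal0sym_obj two"
proof -
  have lub: "is_lub two A (True \<in> A)" for A
    by (auto simp: is_lub_def two_def)
  then have C: "complete_lat two"
    by (auto simp: complete_lat_def two_def)
  have J: "Join two A = (True \<in> A)" for A
    by (rule Join_eqI[OF C _ lub]) (simp add: two_def)
  have M: "Meet two A = (False \<notin> A)" for A
    unfolding Meet_def by (rule Join_eqI[OF complete_lat_dual[OF C]]) (auto simp: two_def is_lub_def, metis)
  show b: "lbot two = False" and t: "ltop two = True"
    by (simp_all add: lbot_def ltop_def J M)
  show a: "atoms two = {True}"
    using b by (auto simp: atoms_def two_def)
  show c: "coatoms two = {False}"
    unfolding coatoms_def atoms_def lbot_dual t by (auto simp: two_def)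
  have below: "atoms_below two x = (if x then {True} else {})" for x
    by (auto simp: atoms_below_def a) (simp_all add: two_def)
  have above: "coatoms_above two x = (if x then {} else {False})" for x
    by (auto simp: coatoms_above_def c) (simp_all add: two_def)
  show "cal0sym_obj two"
    by (auto simp: cal0sym_obj_def C atomistic_def coatomistic_def J M below above a c)
qed

text \<open>The two subsets of \<open>{True}\<close> are the atoms below \<open>False\<close> and
  below \<open>True\<close>, so a fibre in \<open>two\<close> imposes no condition.\<close>

lemma coatomic_sets_two: "{b \<in> atoms two. Q b} \<in> coatomic_sets two"
  by (cases "Q True") (auto simp: coatomic_sets_iff[OF cal0sym_obj_two] atoms_below_def, simp add: two_def)

lemma coatomic_sets_dual_two: "{b \<in> atoms (dual_lat two). Q b} \<in> coatomic_sets (dual_lat two)"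
  by (cases "Q False") (auto simp: coatomic_sets_dual_iff[OF cal0sym_obj_two] coatoms_above_def, simp add: two_def)

lemma
  assumes L: "cal0sym_obj L"
  shows lunit_Hom: "lunit L \<in> Hom (tensor two L) L"
    and lunit_atom: "p \<in> atoms L \<Longrightarrow> lunit L {(True, p)} = p"
proof -
  have G: "{p. (True, p) \<in> X} = {p |b p. (b, p) \<in> X \<and> True}" if "X \<in> lcarrier (tensor two L)" for X
    using that by (auto simp: tensor_carrier_iff)
  note * = tensor_HomI[OF cal0sym_obj_two L L lunit_def G, OF _ _ coatomic_sets_two]
  show "lunit L \<in> Hom (tensor two L) L" "p \<in> atoms L \<Longrightarrow> lunit L {(True, p)} = p"
    using * coatom_coatomic[OF L] by simp_all
qed

lemma
  assumes L: "cal0sym_obj L"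
  shows runit_Hom: "runit L \<in> Hom (tensor L two) L"
    and runit_atom: "p \<in> atoms L \<Longrightarrow> runit L {(p, True)} = p"
proof -
  have G: "{p. (p, True) \<in> X} = {p |p b. (p, b) \<in> X \<and> True}" if "X \<in> lcarrier (tensor L two)" for X
    using that by (auto simp: tensor_carrier_iff)
  note * = tensor_HomI[OF L cal0sym_obj_two L runit_def G, OF _ _ _ coatomic_sets_two]
  show "runit L \<in> Hom (tensor L two) L" "p \<in> atoms L \<Longrightarrow> runit L {(p, True)} = p"
    using * coatom_coatomic[OF L] by simp_all
qed

section \<open>The symmetric monoidal structure\<close>

lemma category_laws_holds: "category_laws L M N f g"
  unfolding category_laws_def using idA_Hom compose_Hom by blast

lemmas Hom_rules = idA_Hom tensor_arr_Hom assoc_Hom symm_Hom lunit_Hom runit_Hom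
  cal0sym_obj_tensor cal0sym_obj_two

text \<open>Evaluation on atoms by conditional rewriting: \<open>Hom_rules\<close> discharges the
  premises about arrows, while \<open>tensor_atomI\<close> and \<open>atom_neq_lbot\<close> decide
  the tests for 0 in \<open>tensor_arr_atom\<close>.\<close>

lemmas atom_rules = compose_atom idA_atom tensor_arr_atom assoc_atom symm_atom lunit_atom runit_atom
  tensor_atomI atom_neq_lbot

lemma tensor_bifunctor_laws_holds: "tensor_bifunctor_laws L1 L2 M1 M2 N1 N2 f1 f2 g1 g2"
  unfolding tensor_bifunctor_laws_def
proof (intro impI, elim conjE, intro conjI)
  assume L: "cal0sym_obj L1" "cal0sym_obj L2" and M: "cal0sym_obj M1" "cal0sym_obj M2"
    and N: "cal0sym_obj N1" "cal0sym_obj N2"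
    and f: "f1 \<in> Hom L1 M1" "f2 \<in> Hom L2 M2" and g: "g1 \<in> Hom M1 N1" "g2 \<in> Hom M2 N2"
  note T = cal0sym_obj_tensor
  show "cal0sym_obj (tensor L1 L2)" by (rule T[OF L])
  show F: "tensor_arr L1 L2 M1 M2 f1 f2 \<in> Hom (tensor L1 L2) (tensor M1 M2)"
    by (rule tensor_arr_Hom[OF L M f])
  show "tensor_arr L1 L2 L1 L2 (idA L1) (idA L2) = idA (tensor L1 L2)"
    by (rule tensor_Hom_eqI[OF L tensor_arr_Hom idA_Hom]) (simp_all add: L Hom_rules atom_rules)
  have c: "compose (lcarrier L1) g1 f1 \<in> Hom L1 N1" "compose (lcarrier L2) g2 f2 \<in> Hom L2 N2"
    using compose_Hom L M N f g by blast+
  have G: "tensor_arr M1 M2 N1 N2 g1 g2 \<in> Hom (tensor M1 M2) (tensor N1 N2)"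
    by (rule tensor_arr_Hom[OF M N g])
  show "tensor_arr L1 L2 N1 N2 (compose (lcarrier L1) g1 f1) (compose (lcarrier L2) g2 f2)
    = compose (lcarrier (tensor L1 L2)) (tensor_arr M1 M2 N1 N2 g1 g2) (tensor_arr L1 L2 M1 M2 f1 f2)"
  proof (rule tensor_Hom_eqI[OF L tensor_arr_Hom[OF L N c] compose_Hom[OF T[OF L] T[OF M] T[OF N] F G]])
    fix p q assume p: "p \<in> atoms L1" and q: "q \<in> atoms L2"
    \<comment> \<open>If \<open>f1 p\<close> or \<open>f2 q\<close> is 0, so is its further image,
      and both sides are empty; otherwise both sides depend on the same tests for
      \<open>g1 (f1 p)\<close> and \<open>g2 (f2 q)\<close>.\<close>
    show "tensor_arr L1 L2 N1 N2 (compose (lcarrier L1) g1 f1) (compose (lcarrier L2) g2 f2) {(p, q)} =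
      compose (lcarrier (tensor L1 L2)) (tensor_arr M1 M2 N1 N2 g1 g2) (tensor_arr L1 L2 M1 M2 f1 f2) {(p, q)}"
      by (cases rule: Hom_atom_cases[OF f(1) p]; cases rule: Hom_atom_cases[OF f(2) q])
        (simp_all add: p q L M N f g c atom_rules T Hom_lbot[OF g(1)] Hom_lbot[OF g(2)]
          Hom_tensor_empty[OF M G] lbot_tensor)
  qed
qed

lemma assoc_iso:
  assumes A: "cal0sym_obj A" and B: "cal0sym_obj B" and C: "cal0sym_obj C"
  shows "iso (tensor (tensor A B) C) (tensor A (tensor B C)) (assoc A B C)"
proof -
  \<comment> \<open>The inverse is obtained by rotating twice more with the associator, interleaved with symmetries.\<close>
  let ?T = "lcarrier (tensor A (tensor B C))"
  note T = cal0sym_obj_tensor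
  note O = A B C T[OF A B] T[OF B C] T[OF C A] T[OF A T[OF B C]] T[OF B T[OF C A]] T[OF C T[OF A B]]
    T[OF T[OF A B] C] T[OF T[OF B C] A] T[OF T[OF C A] B]
  let ?g1 = "compose ?T (assoc B C A) (symm A (tensor B C))"
  let ?g2 = "compose ?T (symm B (tensor C A)) ?g1"
  let ?g3 = "compose ?T (assoc C A B) ?g2"
  let ?g = "compose ?T (symm C (tensor A B)) ?g3"
  have g1: "?g1 \<in> Hom (tensor A (tensor B C)) (tensor B (tensor C A))"
    by (rule compose_Hom[OF _ _ _ symm_Hom assoc_Hom]) (simp_all add: O)
  have g2: "?g2 \<in> Hom (tensor A (tensor B C)) (tensor (tensor C A) B)"
    by (rule compose_Hom[OF _ _ _ g1 symm_Hom]) (simp_all add: O)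
  have g3: "?g3 \<in> Hom (tensor A (tensor B C)) (tensor C (tensor A B))"
    by (rule compose_Hom[OF _ _ _ g2 assoc_Hom]) (simp_all add: O)
  have g: "?g \<in> Hom (tensor A (tensor B C)) (tensor (tensor A B) C)"
    by (rule compose_Hom[OF _ _ _ g3 symm_Hom]) (simp_all add: O)
  show ?thesis
  proof (rule isoI[OF _ _ assoc_Hom g])
    fix P assume "P \<in> atoms (tensor (tensor A B) C)"
    then obtain a b c where "P = {({(a, b)}, c)}" "a \<in> atoms A" "b \<in> atoms B" "c \<in> atoms C"
      by (elim tensor_atomE) (simp_all add: O)
    then show "?g (assoc A B C P) = P"
      by (simp add: O atom_rules)
  next
    fix P assume "P \<in> atoms (tensor A (tensor B C))"
    then obtain a b c where "P = {(a, {(b, c)})}" "a \<in> atoms A" "b \<in> atoms B" "c \<in> atoms C"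
      by (elim tensor_atomE) (simp_all add: O)
    then show "assoc A B C (?g P) = P"
      by (simp add: O atom_rules)
  qed (simp_all add: O)
qed

lemma tensor3_Hom_eqI:
  assumes A: "cal0sym_obj A" and B: "cal0sym_obj B" and C: "cal0sym_obj C"
    and "f \<in> Hom (tensor (tensor A B) C) M" "g \<in> Hom (tensor (tensor A B) C) M"
    and eq: "\<And>a b c. a \<in> atoms A \<Longrightarrow> b \<in> atoms B \<Longrightarrow> c \<in> atoms C \<Longrightarrow> f {({(a, b)}, c)} = g {({(a, b)}, c)}"
  shows "f = g"
  by (rule tensor_Hom_eqI[OF cal0sym_obj_tensor[OF A B] C assms(4,5)])
    (auto elim!: tensor_atomE[OF _ A B] simp: eq)

lemma assoc_laws_holds: "assoc_laws L1 L2 L3 M1 M2 M3 f1 f2 f3"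
  unfolding assoc_laws_def
proof (intro impI, elim conjE, intro conjI)
  assume L: "cal0sym_obj L1" "cal0sym_obj L2" "cal0sym_obj L3"
    and M: "cal0sym_obj M1" "cal0sym_obj M2" "cal0sym_obj M3"
    and f: "f1 \<in> Hom L1 M1" "f2 \<in> Hom L2 M2" "f3 \<in> Hom L3 M3"
  show "iso (tensor (tensor L1 L2) L3) (tensor L1 (tensor L2 L3)) (assoc L1 L2 L3)"
    by (rule assoc_iso[OF L])
  note T = cal0sym_obj_tensor
  let ?f12 = "tensor_arr L1 L2 M1 M2 f1 f2" and ?f23 = "tensor_arr L2 L3 M2 M3 f2 f3"
  let ?F = "tensor_arr L1 (tensor L2 L3) M1 (tensor M2 M3) f1 ?f23"
  let ?G = "tensor_arr (tensor L1 L2) L3 (tensor M1 M2) M3 ?f12 f3"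
  let ?T = "lcarrier (tensor (tensor L1 L2) L3)"
  have H: "?f12 \<in> Hom (tensor L1 L2) (tensor M1 M2)" "?f23 \<in> Hom (tensor L2 L3) (tensor M2 M3)"
    "?F \<in> Hom (tensor L1 (tensor L2 L3)) (tensor M1 (tensor M2 M3))"
    "?G \<in> Hom (tensor (tensor L1 L2) L3) (tensor (tensor M1 M2) M3)"
    "assoc L1 L2 L3 \<in> Hom (tensor (tensor L1 L2) L3) (tensor L1 (tensor L2 L3))"
    "assoc M1 M2 M3 \<in> Hom (tensor (tensor M1 M2) M3) (tensor M1 (tensor M2 M3))"
    by (simp_all add: L M f Hom_rules)
  show "compose ?T ?F (assoc L1 L2 L3) = compose ?T (assoc M1 M2 M3) ?G"
  proof (rule tensor3_Hom_eqI[OF L])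
    show "compose ?T ?F (assoc L1 L2 L3) \<in> Hom (tensor (tensor L1 L2) L3) (tensor M1 (tensor M2 M3))"
      by (rule compose_Hom[OF _ _ _ H(5,3)]) (simp_all add: T L M)
    show "compose ?T (assoc M1 M2 M3) ?G \<in> Hom (tensor (tensor L1 L2) L3) (tensor M1 (tensor M2 M3))"
      by (rule compose_Hom[OF _ _ _ H(4,6)]) (simp_all add: T L M)
    fix a b c assume a: "a \<in> atoms L1" and b: "b \<in> atoms L2" and c: "c \<in> atoms L3"
    \<comment> \<open>Once one of the three images is 0, both sides collapse to the empty relation,
      possibly through an inner tensor arrow whose value is already \<open>{}\<close>.\<close>
    show "compose ?T ?F (assoc L1 L2 L3) {({(a, b)}, c)} = compose ?T (assoc M1 M2 M3) ?G {({(a, b)}, c)}"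
      by (cases rule: Hom_atom_cases[OF f(1) a]; cases rule: Hom_atom_cases[OF f(2) b];
          cases rule: Hom_atom_cases[OF f(3) c])
        (simp_all add: a b c L M f H atom_rules T lbot_tensor
          Hom_tensor_empty[OF T[OF M(1,2)] M(3) H(6)])
  qed
qed

lemma symmetry_laws_holds: "symmetry_laws L1 L2 M1 M2 f1 f2"
  unfolding symmetry_laws_def
proof (intro impI, elim conjE, intro conjI)
  assume L: "cal0sym_obj L1" "cal0sym_obj L2" and M: "cal0sym_obj M1" "cal0sym_obj M2"
    and f: "f1 \<in> Hom L1 M1" "f2 \<in> Hom L2 M2"
  note T = cal0sym_obj_tensor
  let ?T = "lcarrier (tensor L1 L2)"
  show "iso (tensor L1 L2) (tensor L2 L1) (symm L1 L2)"
    by (rule isoI[OF _ _ symm_Hom symm_Hom]) (auto simp: L T atom_rules elim!: tensor_atomE)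
  show "compose ?T (symm L2 L1) (symm L1 L2) = idA (tensor L1 L2)"
    by (rule tensor_Hom_eqI[OF L compose_Hom[OF _ _ _ symm_Hom symm_Hom] idA_Hom])
      (simp_all add: L T atom_rules)
  have F: "tensor_arr L1 L2 M1 M2 f1 f2 \<in> Hom (tensor L1 L2) (tensor M1 M2)"
    "tensor_arr L2 L1 M2 M1 f2 f1 \<in> Hom (tensor L2 L1) (tensor M2 M1)"
    by (simp_all add: L M f Hom_rules)
  show "compose ?T (symm M1 M2) (tensor_arr L1 L2 M1 M2 f1 f2)
    = compose ?T (tensor_arr L2 L1 M2 M1 f2 f1) (symm L1 L2)"
  proof (rule tensor_Hom_eqI[OF L compose_Hom[OF _ _ _ F(1) symm_Hom] compose_Hom[OF _ _ _ symm_Hom F(2)]])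
    fix p q assume p: "p \<in> atoms L1" and q: "q \<in> atoms L2"
    show "compose ?T (symm M1 M2) (tensor_arr L1 L2 M1 M2 f1 f2) {(p, q)}
      = compose ?T (tensor_arr L2 L1 M2 M1 f2 f1) (symm L1 L2) {(p, q)}"
      by (cases rule: Hom_atom_cases[OF f(1) p]; cases rule: Hom_atom_cases[OF f(2) q])
        (simp_all add: p q L M f atom_rules T Hom_tensor_empty[OF M symm_Hom[OF M]] lbot_tensor M)
  qed (simp_all add: L M T)
qed

text \<open>A relation between \<open>two\<close> and \<open>L\<close> is its fibre over the only
  atom \<open>True\<close>, so the unit maps match atoms with atoms and carry coatomic sets to
  fibres, which are coatomic.\<close>

lemma unit_laws_holds: "unit_laws L M f"
  unfolding unit_laws_def
proof (intro impI, elim conjE, intro conjI)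
  assume L: "cal0sym_obj L" and M: "cal0sym_obj M" and f: "f \<in> Hom L M"
  note T = cal0sym_obj_tensor and W = cal0sym_obj_two
  show "iso (tensor two L) L (lunit L)"
  proof (rule iso_if_bij_atoms[OF T[OF W L] L lunit_Hom[OF L]])
    show "bij_betw (lunit L) (atoms (tensor two L)) (atoms L)"
      by (rule bij_betw_byWitness[where f' = "\<lambda>p. {(True, p)}"]) (auto simp: atoms_tensor W L lunit_atom)
    fix R assume R: "R \<in> coatoms (tensor two L)"
    then have "{p \<in> atoms L. (True, p) \<in> R} \<in> coatomic_sets L"
      by (intro tsr_gen_fibres(2)[of R two]) (simp_all add: coatoms_tensor W L)
    moreover have "{P \<in> atoms (tensor two L). lle (tensor two L) P R} = (\<lambda>p. {(True, p)}) ` {p \<in> atoms L. (True, p) \<in> R}"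
      by (auto simp: atoms_tensor W L)
    ultimately show "lunit L ` {P \<in> atoms (tensor two L). lle (tensor two L) P R} \<in> coatomic_sets L"
      by (simp add: image_image lunit_atom[OF L] cong: image_cong_simp)
  qed
  show "iso (tensor L two) L (runit L)"
  proof (rule iso_if_bij_atoms[OF T[OF L W] L runit_Hom[OF L]])
    show "bij_betw (runit L) (atoms (tensor L two)) (atoms L)"
      by (rule bij_betw_byWitness[where f' = "\<lambda>p. {(p, True)}"]) (auto simp: atoms_tensor W L runit_atom)
    fix R assume R: "R \<in> coatoms (tensor L two)"
    then have "{p \<in> atoms L. (p, True) \<in> R} \<in> coatomic_sets L"
      by (intro tsr_gen_fibres(1)[of R L two]) (simp_all add: coatoms_tensor W L)
    moreover have "{P \<in> atoms (tensor L two). lle (tensor L two) P R} = (\<lambda>p. {(p, True)}) ` {p \<in> atoms L. (p, True) \<in> R}"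
      by (auto simp: atoms_tensor W L)
    ultimately show "runit L ` {P \<in> atoms (tensor L two). lle (tensor L two) P R} \<in> coatomic_sets L"
      by (simp add: image_image runit_atom[OF L] cong: image_cong_simp)
  qed
  have F: "tensor_arr two L two M (idA two) f \<in> Hom (tensor two L) (tensor two M)"
    "tensor_arr L two M two f (idA two) \<in> Hom (tensor L two) (tensor M two)"
    by (simp_all add: Hom_rules L M f)
  show "compose (lcarrier (tensor two L)) f (lunit L)
    = compose (lcarrier (tensor two L)) (lunit M) (tensor_arr two L two M (idA two) f)"
  proof (rule tensor_Hom_eqI[OF W L compose_Hom[OF _ _ _ lunit_Hom f] compose_Hom[OF _ _ _ F(1) lunit_Hom]])
    fix b p assume b: "b \<in> atoms two" and p: "p \<in> atoms L"
    show "compose (lcarrier (tensor two L)) f (lunit L) {(b, p)}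
      = compose (lcarrier (tensor two L)) (lunit M) (tensor_arr two L two M (idA two) f) {(b, p)}"
      using b by (cases rule: Hom_atom_cases[OF f p])
        (simp_all add: p L M W f idA_Hom atom_rules T Hom_tensor_empty[OF W M lunit_Hom[OF M]])
  qed (simp_all add: L M T W)
  show "compose (lcarrier (tensor L two)) f (runit L)
    = compose (lcarrier (tensor L two)) (runit M) (tensor_arr L two M two f (idA two))"
  proof (rule tensor_Hom_eqI[OF L W compose_Hom[OF _ _ _ runit_Hom f] compose_Hom[OF _ _ _ F(2) runit_Hom]])
    fix b p assume p: "p \<in> atoms L" and b: "b \<in> atoms two"
    show "compose (lcarrier (tensor L two)) f (runit L) {(p, b)}
      = compose (lcarrier (tensor L two)) (runit M) (tensor_arr L two M two f (idA two)) {(p, b)}"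
      using b by (cases rule: Hom_atom_cases[OF f p])
        (simp_all add: p L M W f idA_Hom atom_rules T Hom_tensor_empty[OF M W runit_Hom[OF M]])
  qed (simp_all add: L M T W)
qed

lemma pentagon_law_holds: "pentagon_law L1 L2 L3 L4"
  unfolding pentagon_law_def
proof (intro impI, elim conjE)
  assume L: "cal0sym_obj L1" "cal0sym_obj L2" "cal0sym_obj L3" "cal0sym_obj L4"
  note T = cal0sym_obj_tensor
  let ?S = "tensor (tensor (tensor L1 L2) L3) L4"
  let ?l = "compose (lcarrier ?S) (assoc L1 L2 (tensor L3 L4)) (assoc (tensor L1 L2) L3 L4)"
  let ?a = "tensor_arr (tensor (tensor L1 L2) L3) L4 (tensor L1 (tensor L2 L3)) L4 (assoc L1 L2 L3) (idA L4)"
  let ?b = "tensor_arr L1 (tensor (tensor L2 L3) L4) L1 (tensor L2 (tensor L3 L4)) (idA L1) (assoc L2 L3 L4)"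
  let ?r1 = "compose (lcarrier ?S) (assoc L1 (tensor L2 L3) L4) ?a"
  let ?r = "compose (lcarrier ?S) ?b ?r1"
  have ab: "?a \<in> Hom ?S (tensor (tensor L1 (tensor L2 L3)) L4)"
    "?b \<in> Hom (tensor L1 (tensor (tensor L2 L3) L4)) (tensor L1 (tensor L2 (tensor L3 L4)))"
    by (simp_all add: Hom_rules L)
  have l: "?l \<in> Hom ?S (tensor L1 (tensor L2 (tensor L3 L4)))"
    by (rule compose_Hom[OF _ _ _ assoc_Hom assoc_Hom]) (simp_all add: L T)
  have r1: "?r1 \<in> Hom ?S (tensor L1 (tensor (tensor L2 L3) L4))"
    by (rule compose_Hom[OF _ _ _ ab(1) assoc_Hom]) (simp_all add: L T)
  have r: "?r \<in> Hom ?S (tensor L1 (tensor L2 (tensor L3 L4)))"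
    by (rule compose_Hom[OF _ _ _ r1 ab(2)]) (simp_all add: L T)
  \<comment> \<open>The first of the three factors is itself a tensor product, so its atoms are
    split once more; \<open>lbot_tensor\<close> shows that no singleton is 0.\<close>
  show "?l = ?r"
    by (rule tensor3_Hom_eqI[OF _ _ _ l r])
      (auto simp: L Hom_rules atom_rules lbot_tensor elim!: tensor_atomE)
qed

lemma triangle_law_holds: "triangle_law L1 L2"
  unfolding triangle_law_def
proof (intro impI, elim conjE)
  assume L: "cal0sym_obj L1" "cal0sym_obj L2"
  note T = cal0sym_obj_tensor and W = cal0sym_obj_two
  let ?S = "tensor (tensor L1 two) L2"
  let ?a = "tensor_arr L1 (tensor two L2) L1 L2 (idA L1) (lunit L2)"
  have a: "?a \<in> Hom (tensor L1 (tensor two L2)) (tensor L1 L2)"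
    "tensor_arr (tensor L1 two) L2 L1 L2 (runit L1) (idA L2) \<in> Hom ?S (tensor L1 L2)"
    by (simp_all add: Hom_rules L)
  have l: "compose (lcarrier ?S) ?a (assoc L1 two L2) \<in> Hom ?S (tensor L1 L2)"
    by (rule compose_Hom[OF _ _ _ assoc_Hom a(1)]) (simp_all add: L T W)
  show "compose (lcarrier ?S) ?a (assoc L1 two L2) = tensor_arr (tensor L1 two) L2 L1 L2 (runit L1) (idA L2)"
    by (rule tensor3_Hom_eqI[OF _ _ _ l a(2)]) (simp_all add: L Hom_rules atom_rules)
qed

lemma hexagon_law_holds: "hexagon_law A B C"
  unfolding hexagon_law_def
proof (intro impI, elim conjE)
  assume O: "cal0sym_obj A" "cal0sym_obj B" "cal0sym_obj C"
  note T = cal0sym_obj_tensor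
  let ?S = "tensor (tensor A B) C"
  let ?l1 = "compose (lcarrier ?S) (symm A (tensor B C)) (assoc A B C)"
  let ?l = "compose (lcarrier ?S) (assoc B C A) ?l1"
  let ?a = "tensor_arr (tensor A B) C (tensor B A) C (symm A B) (idA C)"
  let ?b = "tensor_arr B (tensor A C) B (tensor C A) (idA B) (symm A C)"
  let ?r1 = "compose (lcarrier ?S) (assoc B A C) ?a"
  let ?r = "compose (lcarrier ?S) ?b ?r1"
  have ab: "?a \<in> Hom ?S (tensor (tensor B A) C)" "?b \<in> Hom (tensor B (tensor A C)) (tensor B (tensor C A))"
    by (simp_all add: Hom_rules O)
  have l1: "?l1 \<in> Hom ?S (tensor (tensor B C) A)"
    by (rule compose_Hom[OF _ _ _ assoc_Hom symm_Hom]) (simp_all add: O T)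
  have l: "?l \<in> Hom ?S (tensor B (tensor C A))"
    by (rule compose_Hom[OF _ _ _ l1 assoc_Hom]) (simp_all add: O T)
  have r1: "?r1 \<in> Hom ?S (tensor B (tensor A C))"
    by (rule compose_Hom[OF _ _ _ ab(1) assoc_Hom]) (simp_all add: O T)
  have r: "?r \<in> Hom ?S (tensor B (tensor C A))"
    by (rule compose_Hom[OF _ _ _ r1 ab(2)]) (simp_all add: O T)
  show "?l = ?r"
    by (rule tensor3_Hom_eqI[OF _ _ _ l r]) (simp_all add: O Hom_rules atom_rules lbot_tensor)
qed

section \<open>Internal hom and duality\<close>

lemma Meet_coatoms_above: "cal0sym_obj L \<Longrightarrow> a \<in> lcarrier L \<Longrightarrow> Meet L (coatoms_above L a) = a"
  using atomic_decomp[OF cal0sym_obj_dual, of L a] by (simp add: Join_dual)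

text \<open>Extracts each fibre condition from the joint quantification in
  \<open>coatomic_sets_tensor_iff\<close>. If the factor containing the fibre has no atoms, the
  fibre is empty and equals the full set of atoms, which is coatomic.\<close>

lemma coatomic_sets_tensor_fibres:
  assumes L1: "cal0sym_obj L1" and L2: "cal0sym_obj L2"
    and S: "{P \<in> atoms (tensor L1 L2). Q P} \<in> coatomic_sets (tensor L1 L2)"
  shows "p2 \<in> atoms L2 \<Longrightarrow> {q1 \<in> atoms L1. Q {(q1, p2)}} \<in> coatomic_sets L1"
    and "p1 \<in> atoms L1 \<Longrightarrow> {q2 \<in> atoms L2. Q {(p1, q2)}} \<in> coatomic_sets L2"
proof -
  show "{q1 \<in> atoms L1. Q {(q1, p2)}} \<in> coatomic_sets L1" if "p2 \<in> atoms L2"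
  proof (cases "atoms L1 = {}")
    case True
    then show ?thesis using atoms_coatomic[OF L1] by simp
  next
    case False
    then show ?thesis using S that unfolding coatomic_sets_tensor_iff[OF L1 L2] by blast
  qed
  show "{q2 \<in> atoms L2. Q {(p1, q2)}} \<in> coatomic_sets L2" if "p1 \<in> atoms L1"
  proof (cases "atoms L2 = {}")
    case True
    then show ?thesis using atoms_coatomic[OF L2] by simp
  next
    case False
    then show ?thesis using S that unfolding coatomic_sets_tensor_iff[OF L1 L2] by blast
  qed
qed

section \<open>The internal hom: evaluation and transposition\<close>

context
  fixes L2 :: "'b lat" and L3 :: "'c lat"
  assumes L2: "cal0sym_obj L2" and L3: "cal0sym_obj L3"
begin

private lemmas D3 = cal0sym_obj_dual[OF L3]

lemma cal0sym_obj_ihom: "cal0sym_obj (ihom L2 L3)"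
  unfolding ihom_def by (rule cal0sym_obj_dual[OF cal0sym_obj_tensor[OF L2 D3]])

lemma lle_ihom: "lle (ihom L2 L3) X Y \<longleftrightarrow> Y \<subseteq> X"
  by (simp add: ihom_def)

text \<open>Reversing the order exchanges the roles: generating relations become atoms, single pairs
  become coatoms.\<close>

lemma atoms_ihom: "atoms (ihom L2 L3) = tsr_gen L2 (dual_lat L3)"
  by (simp add: ihom_def coatoms_tensor[OF L2 D3])

lemma coatoms_ihom: "coatoms (ihom L2 L3) = (\<lambda>z. {z}) ` (atoms L2 \<times> coatoms L3)"
  by (simp add: ihom_def atoms_tensor[OF L2 D3])

text \<open>If a map \<open>f\<close> is encoded by the pairs \<open>(q, c)\<close> with
  \<open>f q\<close> below \<open>c\<close>, the full relation encodes the zero map.\<close>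

lemma lbot_ihom: "lbot (ihom L2 L3) = atoms L2 \<times> coatoms L3"
  by (simp add: ihom_def ltop_tensor)

lemma ihom_coatomic:
  "p \<in> atoms L2 \<Longrightarrow> c \<in> coatoms L3 \<Longrightarrow>
    {R \<in> tsr_gen L2 (dual_lat L3). (p, c) \<in> R} \<in> coatomic_sets (ihom L2 L3)"
  using coatom_coatomic[OF cal0sym_obj_ihom, of "{(p, c)}"] by (simp add: coatoms_ihom atoms_ihom lle_ihom)

text \<open>The fibre of \<open>R\<close> over \<open>p\<close> is coatomic in the dual of
  \<open>L3\<close>: it consists of the coatoms above an atom, or of all coatoms, which are those
  above 0. As \<open>L3\<close> is coatomistic, the meet returns this atom or 0 and loses nothing of
  the fibre.\<close>

lemma
  assumes R: "R \<in> tsr_gen L2 (dual_lat L3)" and p: "p \<in> atoms L2"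
  shows Meet_fibre_atom: "Meet L3 {q. (p, q) \<in> R} \<in> atoms L3 \<union> {lbot L3}"
    and Meet_fibre_le: "c \<in> coatoms L3 \<Longrightarrow> lle L3 (Meet L3 {q. (p, q) \<in> R}) c \<longleftrightarrow> (p, c) \<in> R"
proof -
  note C3 = cal0sym_complete[OF L3]
  have "{q. (p, q) \<in> R} = {q \<in> atoms (dual_lat L3). (p, q) \<in> R}"
    using R by (auto simp: tsr_gen_iff)
  also have "\<dots> \<in> coatomic_sets (dual_lat L3)"
    by (rule tsr_gen_fibres(2)[OF R p])
  finally obtain a where a: "a \<in> atoms L3 \<union> {lbot L3}" "{q. (p, q) \<in> R} = coatoms_above L3 a"
    unfolding coatomic_sets_dual_iff[OF L3] using coatoms_above_lbot[OF C3] by blast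
  then have M: "Meet L3 {q. (p, q) \<in> R} = a"
    using atoms_carrier[OF C3] lbot_carrier[OF C3] by (auto simp: Meet_coatoms_above[OF L3])
  show "Meet L3 {q. (p, q) \<in> R} \<in> atoms L3 \<union> {lbot L3}"
    using a(1) by (simp only: M)
  have "(p, c) \<in> R \<longleftrightarrow> c \<in> coatoms_above L3 a" for c
    using a(2) by auto
  then show "c \<in> coatoms L3 \<Longrightarrow> lle L3 (Meet L3 {q. (p, q) \<in> R}) c \<longleftrightarrow> (p, c) \<in> R"
    unfolding M by (simp add: coatoms_above_def)
qed

text \<open>For a coatom \<open>c\<close>, fixing \<open>p\<close> leaves the relations containing
  \<open>(p, c)\<close>, which are the atoms below the coatom \<open>{(p, c)}\<close> of the
  internal hom; fixing \<open>R\<close> leaves a fibre of \<open>R\<close>.\<close>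

lemma
  shows ev_Hom: "ev L2 L3 \<in> Hom (tensor (ihom L2 L3) L2) L3"
    and ev_atom: "R \<in> tsr_gen L2 (dual_lat L3) \<Longrightarrow> p \<in> atoms L2 \<Longrightarrow>
      ev L2 L3 {(R, p)} = Meet L3 {q. (p, q) \<in> R}"
proof -
  have G: "{Meet L3 {q. (p2, q) \<in> R} |R p2. (R, p2) \<in> X} = {Meet L3 {q. (p2, q) \<in> R} |R p2. (R, p2) \<in> X \<and> True}"
    for X :: "(('b \<times> 'c) set \<times> 'b) set"
    by simp
  have at: "Meet L3 {q. (p, q) \<in> R} \<in> atoms L3 \<union> {lbot L3}"
    if "R \<in> atoms (ihom L2 L3)" "p \<in> atoms L2" for R p
    using Meet_fibre_atom that by (simp only: atoms_ihom)
  have pre1: "{R \<in> atoms (ihom L2 L3). True \<longrightarrow> lle L3 (Meet L3 {q. (p, q) \<in> R}) c} \<in> coatomic_sets (ihom L2 L3)"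
    if "c \<in> coatoms L3" "p \<in> atoms L2" for c p
    using ihom_coatomic[OF that(2,1)] that by (simp add: atoms_ihom Meet_fibre_le cong: conj_cong)
  have pre2: "{p \<in> atoms L2. True \<longrightarrow> lle L3 (Meet L3 {q. (p, q) \<in> R}) c} \<in> coatomic_sets L2"
    if "c \<in> coatoms L3" "R \<in> atoms (ihom L2 L3)" for c R
    using tsr_gen_fibres(1)[of R L2 "dual_lat L3" c] that by (simp add: atoms_ihom Meet_fibre_le cong: conj_cong)
  note * = tensor_HomI[OF cal0sym_obj_ihom L2 L3 ev_def G at pre1 pre2]
  show "ev L2 L3 \<in> Hom (tensor (ihom L2 L3) L2) L3"
    by (rule *(1))
  show "R \<in> tsr_gen L2 (dual_lat L3) \<Longrightarrow> p \<in> atoms L2 \<Longrightarrow> ev L2 L3 {(R, p)} = Meet L3 {q. (p, q) \<in> R}"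
    by (subst *(2)) (simp_all add: atoms_ihom)
qed

text \<open>The composite at \<open>(p, q)\<close> lies below \<open>c\<close> exactly when
  \<open>(q, c)\<close> belongs to \<open>g p\<close>, so the equation prescribes \<open>g\<close>
  on atoms. As an equivalence it serves both existence and uniqueness of transposes.\<close>

lemma transpose_iff:
  assumes L1: "cal0sym_obj L1" and f: "f \<in> Hom (tensor L1 L2) L3" and g: "g \<in> Hom L1 (ihom L2 L3)"
  shows "compose (lcarrier (tensor L1 L2)) (ev L2 L3) (tensor_arr L1 L2 (ihom L2 L3) L2 g (idA L2)) = f
    \<longleftrightarrow> (\<forall>p\<in>atoms L1. g p = {(q, c) \<in> atoms L2 \<times> coatoms L3. lle L3 (f {(p, q)}) c})"
    (is "?F = f \<longleftrightarrow> ?r")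
proof -
  note H = cal0sym_obj_ihom and T = cal0sym_obj_tensor and C3 = cal0sym_complete[OF L3]
  have F: "?F \<in> Hom (tensor L1 L2) L3"
    by (rule compose_Hom[OF _ _ _ tensor_arr_Hom ev_Hom]) (simp_all add: L1 L2 L3 H T g idA_Hom)
  have val: "lle L3 (?F {(p, q)}) c \<longleftrightarrow> (q, c) \<in> g p"
    if p: "p \<in> atoms L1" and q: "q \<in> atoms L2" and c: "c \<in> coatoms L3" for p q c
  proof (cases rule: Hom_atom_cases[OF g p])
    \<comment> \<open>The bottom of the internal hom is the full relation, in agreement with 0 lying
      below every coatom.\<close>
    case 1
    then have "?F {(p, q)} = lbot L3"
      by (simp add: atom_rules L1 L2 T H p q g idA_Hom Hom_tensor_empty[OF H L2 ev_Hom])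
    then show ?thesis
      using 1 q c lbot_least[OF C3 coatoms_carrier[OF C3 c]] by (simp add: lbot_ihom)
  next
    case 2
    then have "?F {(p, q)} = Meet L3 {c. (q, c) \<in> g p}"
      using q by (simp add: atom_rules L1 L2 T H p g idA_Hom ev_atom atoms_ihom)
    then show ?thesis
      using 2 q c by (simp add: Meet_fibre_le atoms_ihom)
  qed
  have sub: "g p \<subseteq> atoms L2 \<times> coatoms L3" if "p \<in> atoms L1" for p
    using HomD(4)[OF g that] by (auto simp: atoms_ihom lbot_ihom tsr_gen_iff)
  show ?thesis
  proof
    assume "?F = f"
    then have "(q, c) \<in> g p \<longleftrightarrow> lle L3 (f {(p, q)}) c" if "p \<in> atoms L1" "q \<in> atoms L2" "c \<in> coatoms L3" for p q c
      using val[OF that] by simp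
    then show ?r
      using sub by blast
  next
    assume r: ?r
    show "?F = f"
    proof (rule tensor_Hom_eqI[OF L1 L2 F f], rule coatoms_eqI[OF L3])
      fix p q assume p: "p \<in> atoms L1" and q: "q \<in> atoms L2"
      then have P: "{(p, q)} \<in> lcarrier (tensor L1 L2)"
        by (simp add: singleton_tensor_carrier[OF L1 L2])
      show "?F {(p, q)} \<in> lcarrier L3" "f {(p, q)} \<in> lcarrier L3"
        by (rule HomD(2)[OF F P], rule HomD(2)[OF f P])
      fix c assume c: "c \<in> coatoms L3"
      show "lle L3 (?F {(p, q)}) c \<longleftrightarrow> lle L3 (f {(p, q)}) c"
        unfolding val[OF p q c] using r p q c by auto
    qed
  qed
qed

text \<open>The ternary relation must be coatomic in all three variables. For those in
  \<open>L1\<close> and \<open>L2\<close> this is the preimage condition for \<open>f\<close> at the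
  coatom \<open>c\<close>; for \<open>c\<close> itself it holds because \<open>f {(p, q)}\<close> is
  an atom or 0.\<close>

lemma transpose_exists:
  assumes L1: "cal0sym_obj L1" and f: "f \<in> Hom (tensor L1 L2) L3"
  shows "\<exists>g \<in> Hom L1 (ihom L2 L3).
    \<forall>p\<in>atoms L1. g p = {(q, c) \<in> atoms L2 \<times> coatoms L3. lle L3 (f {(p, q)}) c}"
proof -
  note T = cal0sym_obj_tensor[OF L1 L2] and C3 = cal0sym_complete[OF L3]
  define \<phi> where "\<phi> p = {(q, c) \<in> atoms L2 \<times> coatoms L3. lle L3 (f {(p, q)}) c}" for p
  have "{P \<in> atoms (tensor L1 L2). lle L3 (f P) c} \<in> coatomic_sets (tensor L1 L2)"
    if "c \<in> coatoms L3" for c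
    by (rule Hom_preimage_coatomic[OF T L3 f coatom_coatomic[OF L3 that] coatoms_carrier[OF C3 that]])
  note fib = coatomic_sets_tensor_fibres[OF L1 L2 this]
  have up: "{c \<in> coatoms L3. lle L3 (f {(p, q)}) c} \<in> coatomic_sets (dual_lat L3)"
    if "p \<in> atoms L1" "q \<in> atoms L2" for p q
    using HomD(4)[OF f tensor_atomI[OF L1 L2 that]] coatoms_above_lbot[OF C3]
    by (auto simp: coatomic_sets_dual_iff[OF L3] coatoms_above_def)
  have at: "\<phi> p \<in> atoms (ihom L2 L3) \<union> {lbot (ihom L2 L3)}" if p: "p \<in> atoms L1" for p
  proof -
    have "fibrewise_coatomic L2 (dual_lat L3) (\<phi> p)"
      using fib(2)[OF _ p] up[OF p] by (simp add: fibrewise_coatomic_def \<phi>_def cong: conj_cong)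
    \<comment> \<open>A proper fibrewise coatomic relation is an atom of the internal hom; if \<phi>
      maps \<open>p\<close> to the full relation, the value is the bottom.\<close>
    then show ?thesis
      by (auto simp: atoms_ihom lbot_ihom tsr_gen_iff \<phi>_def)
  qed
  have pre: "{p \<in> atoms L1. lle (ihom L2 L3) (\<phi> p) z} \<in> coatomic_sets L1"
    if "z \<in> coatoms (ihom L2 L3)" for z
    using that fib(1) by (auto simp: coatoms_ihom lle_ihom \<phi>_def)
  show ?thesis
    using atom_extension_Hom[OF L1 cal0sym_obj_ihom at pre] unfolding \<phi>_def by blast
qed

end

lemma closed_law_holds: "closed_law L1 L2 L3"
  unfolding closed_law_def
proof (intro impI, elim conjE, intro conjI ballI)
  assume L1: "cal0sym_obj L1" and L2: "cal0sym_obj L2" and L3: "cal0sym_obj L3"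
  show "cal0sym_obj (ihom L2 L3)" "ev L2 L3 \<in> Hom (tensor (ihom L2 L3) L2) L3"
    by (rule cal0sym_obj_ihom[OF L2 L3], rule ev_Hom[OF L2 L3])
  fix f assume f: "f \<in> Hom (tensor L1 L2) L3"
  note iff = transpose_iff[OF L2 L3 L1 f]
  show "\<exists>!g. g \<in> Hom L1 (ihom L2 L3) \<and>
    compose (lcarrier (tensor L1 L2)) (ev L2 L3) (tensor_arr L1 L2 (ihom L2 L3) L2 g (idA L2)) = f"
  proof (rule ex_ex1I)
    show "\<exists>g. g \<in> Hom L1 (ihom L2 L3) \<and>
      compose (lcarrier (tensor L1 L2)) (ev L2 L3) (tensor_arr L1 L2 (ihom L2 L3) L2 g (idA L2)) = f"
      using transpose_exists[OF L2 L3 L1 f] iff by blast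
  next
    let ?ev = "\<lambda>g. compose (lcarrier (tensor L1 L2)) (ev L2 L3) (tensor_arr L1 L2 (ihom L2 L3) L2 g (idA L2))"
    fix g h
    assume "g \<in> Hom L1 (ihom L2 L3) \<and> ?ev g = f" and "h \<in> Hom L1 (ihom L2 L3) \<and> ?ev h = f"
    then have g: "g \<in> Hom L1 (ihom L2 L3)" "?ev g = f" and h: "h \<in> Hom L1 (ihom L2 L3)" "?ev h = f"
      by simp_all
    show "g = h"
      by (rule Hom_eqI[OF L1 g(1) h(1)])
        (simp add: bspec[OF iffD1[OF iff[OF g(1)] g(2)]] bspec[OF iffD1[OF iff[OF h(1)] h(2)]])
  qed
qed

section \<open>Duals and the dualizing object\<close>

lemma tsr_gen_dual_two:
  assumes L: "cal0sym_obj L"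
  shows "tsr_gen L (dual_lat two) = (\<lambda>c. atoms_below L c \<times> {False}) ` coatoms L"
proof (intro equalityI subsetI)
  fix R assume R: "R \<in> tsr_gen L (dual_lat two)"
  \<comment> \<open>The dual of \<open>two\<close> has \<open>False\<close> as its only atom, so
    \<open>R\<close> is its fibre over \<open>False\<close>, which is proper because
    \<open>R\<close> is.\<close>
  define S where "S = {p \<in> atoms L. (p, False) \<in> R}"
  have RS: "R = S \<times> {False}" and "S \<noteq> atoms L"
    using R by (auto simp: S_def tsr_gen_iff)
  moreover have "S \<in> coatomic_sets L"
    unfolding S_def by (rule tsr_gen_fibres(1)[OF R]) simp
  ultimately show "R \<in> (\<lambda>c. atoms_below L c \<times> {False}) ` coatoms L"
    by (auto simp: coatomic_sets_iff[OF L])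
next
  fix R assume "R \<in> (\<lambda>c. atoms_below L c \<times> {False}) ` coatoms L"
  then obtain c where c: "c \<in> coatoms L" and R: "R = atoms_below L c \<times> {False}"
    by blast
  have "{q \<in> atoms (dual_lat two). (p, q) \<in> R} \<in> coatomic_sets (dual_lat two)" for p
    by (rule coatomic_sets_dual_two)
  moreover have "{p \<in> atoms L. (p, False) \<in> R} \<in> coatomic_sets L"
    using coatom_coatomic[OF L c] by (simp add: R atoms_below_def cong: conj_cong)
  moreover have "R \<subset> atoms L \<times> {False}"
    using coatoms_separate_atoms[OF L c c] by (auto simp: R atoms_below_def)
  ultimately show "R \<in> tsr_gen L (dual_lat two)"
    by (auto simp: tsr_gen_iff fibrewise_coatomic_def)
qed

text \<open>An atom of \<open>ihom L two\<close> encodes a coatom \<open>c\<close> by the atoms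
  below it, and their join recovers \<open>c\<close>, an atom of the dual. A coatom
  \<open>{(p, False)}\<close> corresponds to the atom \<open>p\<close> of \<open>L\<close>, a coatom
  of the dual.\<close>

lemma ihom_two_iso_dual:
  assumes L: "cal0sym_obj L"
  shows "\<exists>h. iso (ihom L two) (dual_lat L) h"
proof -
  note W = cal0sym_obj_two and C = cal0sym_complete[OF L]
  note H = cal0sym_obj_ihom[OF L W]
  define \<phi> where "\<phi> R = Join L {p. (p, False) \<in> R}" for R :: "('a \<times> bool) set"
  have \<phi>: "\<phi> (atoms_below L c \<times> {False}) = c" if "c \<in> coatoms L" for c
    using atomic_decomp[OF L coatoms_carrier[OF C that]] by (simp add: \<phi>_def)
  have atH: "atoms (ihom L two) = (\<lambda>c. atoms_below L c \<times> {False}) ` coatoms L"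
    by (simp add: atoms_ihom[OF L W] tsr_gen_dual_two[OF L])
  have at: "\<phi> R \<in> atoms (dual_lat L) \<union> {lbot (dual_lat L)}" if "R \<in> atoms (ihom L two)" for R
    using that by (auto simp: atH \<phi>)
  have le: "lle L p (\<phi> R) \<longleftrightarrow> (p, False) \<in> R" if R: "R \<in> atoms (ihom L two)" and p: "p \<in> atoms L" for R p
  proof -
    obtain c where c: "c \<in> coatoms L" "R = atoms_below L c \<times> {False}"
      using R unfolding atH by blast
    show ?thesis
      unfolding c(2) \<phi>[OF c(1)] using p by (simp add: atoms_below_def)
  qed
  have pre: "{R \<in> atoms (ihom L two). lle (dual_lat L) (\<phi> R) p} \<in> coatomic_sets (ihom L two)"
    if p: "p \<in> coatoms (dual_lat L)" for p
  proof -
    have "{R \<in> atoms (ihom L two). lle (dual_lat L) (\<phi> R) p} = {R \<in> atoms (ihom L two). (p, False) \<in> R}"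
      using le p by (intro Collect_cong conj_cong refl) simp
    also have "\<dots> \<in> coatomic_sets (ihom L two)"
      using ihom_coatomic[OF L W, of p False] p by (simp add: atoms_ihom[OF L W])
    finally show ?thesis .
  qed
  note ext = atom_extension_Hom[OF H cal0sym_obj_dual[OF L] at pre]
  let ?h = "atom_extension (ihom L two) (dual_lat L) \<phi>"
  have "iso (ihom L two) (dual_lat L) ?h"
  proof (rule iso_if_bij_atoms[OF H cal0sym_obj_dual[OF L] ext(1)])
    show "bij_betw ?h (atoms (ihom L two)) (atoms (dual_lat L))"
      by (rule bij_betw_byWitness[where f' = "\<lambda>c. atoms_below L c \<times> {False}"])
        (use ext(2) in \<open>auto simp: atH \<phi>\<close>)
    fix z assume "z \<in> coatoms (ihom L two)"
    then obtain p where p: "p \<in> atoms L" "z = {(p, False)}"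
      by (auto simp: coatoms_ihom[OF L W])
    have "{R \<in> atoms (ihom L two). lle (ihom L two) R z} = (\<lambda>c. atoms_below L c \<times> {False}) ` coatoms_above L p"
      using p by (auto simp: atH lle_ihom[OF L W] atoms_below_def coatoms_above_def)
    moreover have "?h (atoms_below L c \<times> {False}) = c" if "c \<in> coatoms_above L p" for c
      using that ext(2) \<phi> by (auto simp: atH coatoms_above_def)
    ultimately have "?h ` {R \<in> atoms (ihom L two). lle (ihom L two) R z} = coatoms_above L p"
      by (simp add: image_image cong: image_cong_simp)
    then show "?h ` {R \<in> atoms (ihom L two). lle (ihom L two) R z} \<in> coatomic_sets (dual_lat L)"
      using p by (auto simp: coatomic_sets_dual_iff[OF L])
  qed
  then show ?thesis by blast
qed

text \<open>The transpose sends an atom \<open>p\<close> to the encoding, by the atoms below it, of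
  the coatom \<open>{(p, False)}\<close> of \<open>ihom L two\<close>. Every atom of the double
  internal hom is such an encoding, so the transpose is bijective on atoms.\<close>

lemma dualizing_law_holds: "dualizing_law L"
  unfolding dualizing_law_def
proof (intro impI conjI)
  assume L: "cal0sym_obj L"
  show "\<exists>h. iso (ihom L two) (dual_lat L) h"
    by (rule ihom_two_iso_dual[OF L])
  note W = cal0sym_obj_two and T = cal0sym_obj_tensor
  let ?H = "ihom L two"
  let ?K = "ihom ?H two"
  note H = cal0sym_obj_ihom[OF L W]
  note K = cal0sym_obj_ihom[OF H W]
  let ?f = "compose (lcarrier (tensor L ?H)) (ev L two) (symm L ?H)"
  have f: "?f \<in> Hom (tensor L ?H) two"
    by (rule compose_Hom[OF _ _ _ symm_Hom ev_Hom]) (simp_all add: L H W T)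
  obtain g where g: "g \<in> Hom L ?K"
    and gp: "\<And>p. p \<in> atoms L \<Longrightarrow> g p = {(R, c) \<in> atoms ?H \<times> coatoms two. lle two (?f {(p, R)}) c}"
    using transpose_exists[OF H W L f] by blast
  have eq: "compose (lcarrier (tensor L ?H)) (ev ?H two) (tensor_arr L ?H ?K ?H g (idA ?H)) = ?f"
    using transpose_iff[OF H W L f g] gp by blast
  have atH: "atoms ?H = tsr_gen L (dual_lat two)"
    by (rule atoms_ihom[OF L W])
  have atK: "atoms ?K = (\<lambda>z. atoms_below ?H z \<times> {False}) ` coatoms ?H"
    by (simp add: atoms_ihom[OF H W] tsr_gen_dual_two[OF H])
  have coH: "coatoms ?H = (\<lambda>p. {(p, False)}) ` atoms L"
    by (auto simp: coatoms_ihom[OF L W])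
  have f_le: "lle two (?f {(p, R)}) False \<longleftrightarrow> (p, False) \<in> R" if "p \<in> atoms L" "R \<in> atoms ?H" for p R
    using that by (simp add: atom_rules L H W T ev_atom[OF L W] Meet_fibre_le[OF L W] atH)
  have g_eq: "g p = atoms_below ?H {(p, False)} \<times> {False}" if "p \<in> atoms L" for p
    using f_le[OF that] by (auto simp: gp[OF that] atoms_below_def lle_ihom[OF L W])
  have "iso L ?K g"
  proof (rule iso_if_bij_atoms[OF L K g])
    have "p = q" if "p \<in> atoms L" "q \<in> atoms L" "g p = g q" for p q
    proof -
      have "atoms_below ?H {(p, False)} = atoms_below ?H {(q, False)}"
        using that g_eq by auto
      then have "{(p, False)} = {(q, False)}"
        using that coatoms_carrier[OF cal0sym_complete[OF H]]
        by (intro atoms_below_inj[OF H]) (auto simp: coH)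
      then show ?thesis by simp
    qed
    moreover have "g ` atoms L = atoms ?K"
      using g_eq by (simp add: atK coH image_image cong: image_cong_simp)
    ultimately show "bij_betw g (atoms L) (atoms ?K)"
      by (auto simp: bij_betw_def inj_on_def)
    fix c assume c: "c \<in> coatoms L"
    \<comment> \<open>The coatom \<open>c\<close> is encoded by the atom \<open>R\<close> of
      \<open>?H\<close>, hence by the coatom \<open>{(R, False)}\<close> of \<open>?K\<close>; the
      image of the atoms below \<open>c\<close> consists of the atoms below that coatom.\<close>
    define R where "R = atoms_below L c \<times> {False}"
    have R: "R \<in> atoms ?H"
      using c by (auto simp: atH tsr_gen_dual_two[OF L] R_def)
    have "(R, False) \<in> g p \<longleftrightarrow> lle L p c" if "p \<in> atoms L" for p
      using that R by (simp add: g_eq atoms_below_def lle_ihom[OF L W] R_def)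
    then have "g ` {p \<in> atoms L. lle L p c} = {S \<in> g ` atoms L. (R, False) \<in> S}"
      by auto
    also have "\<dots> = {S \<in> tsr_gen ?H (dual_lat two). (R, False) \<in> S}"
      by (simp add: \<open>g ` atoms L = atoms ?K\<close> atoms_ihom[OF H W])
    also have "\<dots> \<in> coatomic_sets ?K"
      by (rule ihom_coatomic[OF H W R]) simp
    finally show "g ` {p \<in> atoms L. lle L p c} \<in> coatomic_sets ?K" .
  qed
  with g eq show "\<exists>g. g \<in> Hom L ?K \<and>
    compose (lcarrier (tensor L ?H)) (ev ?H two) (tensor_arr L ?H ?K ?H g (idA ?H)) = ?f \<and> iso L ?K g"
    by blast
qed

theorem theorem5p5:
  shows "cal0sym_obj two \<and>
    (\<forall>L. cal0sym_obj L \<longrightarrow> cal0sym_obj (dual_lat L)) \<and>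
    (\<forall>L M N f g. category_laws L M N f g) \<and>
    (\<forall>L1 L2 M1 M2 N1 N2 f1 f2 g1 g2. tensor_bifunctor_laws L1 L2 M1 M2 N1 N2 f1 f2 g1 g2) \<and>
    (\<forall>L1 L2 L3 M1 M2 M3 f1 f2 f3. assoc_laws L1 L2 L3 M1 M2 M3 f1 f2 f3) \<and>
    (\<forall>L M f. unit_laws L M f) \<and>
    (\<forall>L1 L2 M1 M2 f1 f2. symmetry_laws L1 L2 M1 M2 f1 f2) \<and>
    (\<forall>L1 L2 L3 L4. pentagon_law L1 L2 L3 L4) \<and>
    (\<forall>L1 L2. triangle_law L1 L2) \<and>
    (\<forall>A B C. hexagon_law A B C) \<and>
    (\<forall>L1 L2 L3. closed_law L1 L2 L3) \<and>
    (\<forall>L. dualizing_law L)"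
  by (simp add: cal0sym_obj_two cal0sym_obj_dual category_laws_holds
      tensor_bifunctor_laws_holds assoc_laws_holds unit_laws_holds symmetry_laws_holds
      pentagon_law_holds triangle_law_holds hexagon_law_holds closed_law_holds dualizing_law_holds)

end
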